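(* Let $G$ be a CSA$^\ast$-group, let $A,B$ be subgroups of $G$, let $\phi:A\to B$ be an isomorphism, and let $G^\ast=\langle G,t\mid t^{-1}at=\phi(a),\ a\in A\rangle$ be the associated HNN-extension. Suppose that $G^\ast$ is strictly separated, that $A=\mathrm{mal}_G(A)$, and that $B$ is a normal subgroup of $\mathrm{mal}_G(B)$. Then $G^\ast$ is a CSA$^\ast$-group.
   Context: Notation: $H^x=x^{-1}Hx$. A subgroup $H$ of a group $G$ is malnormal (conjugate separated) if $H\cap H^x=1$ for all $x\in G\setminus H$. Intersections of malnormal subgroups are malnormal; the malnormal closure $\mathrm{mal}_G(A)$ of a subgroup $A\le G$ is the intersection of all malnormal subgroups of $G$ containing $A$. A group is a CSA-group if all its maximal abelian subgroups are malnormal. A CSA$^\ast$-group is a CSA-group without elements of order 2. The HNN-extension $G^\ast$ is strictly separated if $A\cap g^{-1}\mathrm{mal}_G(B)g=1$ for all $g\in G$. *)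

theory Defs
  imports "HOL-Algebra.Algebra"
begin

definition conj_set :: "('a, 'b) monoid_scheme \<Rightarrow> 'a set \<Rightarrow> 'a \<Rightarrow> 'a set" where
  "conj_set G H x = {inv\<^bsub>G\<^esub> x \<otimes>\<^bsub>G\<^esub> h \<otimes>\<^bsub>G\<^esub> x |h. h \<in> H}"

definition malnormal :: "'a set \<Rightarrow> ('a, 'b) monoid_scheme \<Rightarrow> bool" where
  "malnormal H G \<longleftrightarrow> subgroup H G \<and>
     (\<forall>x \<in> carrier G - H. H \<inter> conj_set G H x = {\<one>\<^bsub>G\<^esub>})"

definition mal_closure :: "('a, 'b) monoid_scheme \<Rightarrow> 'a set \<Rightarrow> 'a set" where
  "mal_closure G A = \<Inter>{H. malnormal H G \<and> A \<subseteq> H}"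

definition abelian_subgroup :: "'a set \<Rightarrow> ('a, 'b) monoid_scheme \<Rightarrow> bool" where
  "abelian_subgroup M G \<longleftrightarrow> subgroup M G \<and> comm_group (G\<lparr>carrier := M\<rparr>)"

definition maximal_abelian_subgroup :: "'a set \<Rightarrow> ('a, 'b) monoid_scheme \<Rightarrow> bool" where
  "maximal_abelian_subgroup M G \<longleftrightarrow> abelian_subgroup M G \<and>
     (\<forall>N. abelian_subgroup N G \<and> M \<subseteq> N \<longrightarrow> N = M)"

definition CSA_group :: "('a, 'b) monoid_scheme \<Rightarrow> bool" where
  "CSA_group G \<longleftrightarrow> group G \<and> (\<forall>M. maximal_abelian_subgroup M G \<longrightarrow> malnormal M G)"

definition CSA_star_group :: "('a, 'b) monoid_scheme \<Rightarrow> bool" where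
  "CSA_star_group G \<longleftrightarrow> CSA_group G \<and> (\<forall>x \<in> carrier G. group.ord G x \<noteq> 2)"

text \<open>
  The HNN-extension is built from its presentation: its elements are classes of words in the
  elements of \<open>G\<close>, the stable letter \<open>t\<close> and its formal inverse, modulo the smallest congruence
  containing the multiplication table of \<open>G\<close>, the two cancellation rules for \<open>t\<close>, and
  \<open>t\<^sup>-\<^sup>1at = \<phi>(a)\<close> for \<open>a \<in> A\<close>.
\<close>

datatype 'a hnn_letter = Base 'a | Stable | StableInv

definition hnn_words :: "('a, 'b) monoid_scheme \<Rightarrow> 'a hnn_letter list set" where
  "hnn_words G = lists (Base ` carrier G \<union> {Stable, StableInv})"

inductive_set hnn_rel ::
    "('a, 'b) monoid_scheme \<Rightarrow> 'a set \<Rightarrow> ('a \<Rightarrow> 'a) \<Rightarrow> ('a hnn_letter list \<times> 'a hnn_letter list) set"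
  for G :: "('a, 'b) monoid_scheme" and A :: "'a set" and \<phi> :: "'a \<Rightarrow> 'a"
where
  refl: "w \<in> hnn_words G \<Longrightarrow> (w, w) \<in> hnn_rel G A \<phi>"
| sym: "(u, v) \<in> hnn_rel G A \<phi> \<Longrightarrow> (v, u) \<in> hnn_rel G A \<phi>"
| trans: "(u, v) \<in> hnn_rel G A \<phi> \<Longrightarrow> (v, w) \<in> hnn_rel G A \<phi> \<Longrightarrow> (u, w) \<in> hnn_rel G A \<phi>"
| append: "(u, v) \<in> hnn_rel G A \<phi> \<Longrightarrow> (u', v') \<in> hnn_rel G A \<phi> \<Longrightarrow>
    (u @ u', v @ v') \<in> hnn_rel G A \<phi>"
| base_one: "([Base \<one>\<^bsub>G\<^esub>], []) \<in> hnn_rel G A \<phi>"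
| base_mult: "g \<in> carrier G \<Longrightarrow> h \<in> carrier G \<Longrightarrow>
    ([Base g, Base h], [Base (g \<otimes>\<^bsub>G\<^esub> h)]) \<in> hnn_rel G A \<phi>"
| stable_right: "([Stable, StableInv], []) \<in> hnn_rel G A \<phi>"
| stable_left: "([StableInv, Stable], []) \<in> hnn_rel G A \<phi>"
| stable_conj: "a \<in> A \<Longrightarrow> ([StableInv, Base a, Stable], [Base (\<phi> a)]) \<in> hnn_rel G A \<phi>"

definition hnn_extension ::
    "('a, 'b) monoid_scheme \<Rightarrow> 'a set \<Rightarrow> ('a \<Rightarrow> 'a) \<Rightarrow> 'a hnn_letter list set monoid" where
  "hnn_extension G A \<phi> =
     \<lparr>carrier = hnn_words G // hnn_rel G A \<phi>,
      monoid.mult = (\<lambda>U V. \<Union>u\<in>U. \<Union>v\<in>V. hnn_rel G A \<phi> `` {u @ v}),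
      one = hnn_rel G A \<phi> `` {[]}\<rparr>"

definition hnn_base :: "('a, 'b) monoid_scheme \<Rightarrow> 'a set \<Rightarrow> ('a \<Rightarrow> 'a) \<Rightarrow> 'a \<Rightarrow> 'a hnn_letter list set" where
  "hnn_base G A \<phi> g = hnn_rel G A \<phi> `` {[Base g]}"

definition hnn_stable :: "('a, 'b) monoid_scheme \<Rightarrow> 'a set \<Rightarrow> ('a \<Rightarrow> 'a) \<Rightarrow> 'a hnn_letter list set" where
  "hnn_stable G A \<phi> = hnn_rel G A \<phi> `` {[Stable]}"

definition hnn_strictly_separated :: "('a, 'b) monoid_scheme \<Rightarrow> 'a set \<Rightarrow> 'a set \<Rightarrow> bool" where
  "hnn_strictly_separated G A B \<longleftrightarrow>
     (\<forall>g \<in> carrier G. A \<inter> conj_set G (mal_closure G B) g = {\<one>\<^bsub>G\<^esub>})"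

locale hnn_data = group G for G (structure) +
  fixes A :: "'a set" and \<phi> :: "'a \<Rightarrow> 'a"
  assumes A_sub: "A \<subseteq> carrier G" and phi_closed: "\<And>a. a \<in> A \<Longrightarrow> \<phi> a \<in> carrier G"
begin

abbreviation R where "R \<equiv> hnn_rel G A \<phi>"
abbreviation H where "H \<equiv> hnn_extension G A \<phi>"

lemma words_simps [simp]:
  "[] \<in> hnn_words G"
  "x # w \<in> hnn_words G \<longleftrightarrow>
     (x \<in> Base ` carrier G \<or> x = Stable \<or> x = StableInv) \<and> w \<in> hnn_words G"
  "u @ v \<in> hnn_words G \<longleftrightarrow> u \<in> hnn_words G \<and> v \<in> hnn_words G"
  by (auto simp: hnn_words_def)

lemma rel_words: "(u, v) \<in> R \<Longrightarrow> u \<in> hnn_words G \<and> v \<in> hnn_words G"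
  by (induction rule: hnn_rel.induct) (use A_sub phi_closed in auto)

lemma equiv_rel: "equiv (hnn_words G) R"
  unfolding equiv_def refl_on_def sym_def trans_def
  using rel_words by (auto intro: hnn_rel.refl hnn_rel.sym hnn_rel.trans)

lemma class_in_carrier: "w \<in> hnn_words G \<Longrightarrow> R `` {w} \<in> carrier H"
  by (simp add: hnn_extension_def quotientI)

lemma class_eq_iff: "(u, v) \<in> R \<Longrightarrow> R `` {u} = R `` {v}"
  by (rule equiv_class_eq[OF equiv_rel])

lemma class_mult:
  assumes "u \<in> hnn_words G" "v \<in> hnn_words G"
  shows "R `` {u} \<otimes>\<^bsub>H\<^esub> R `` {v} = R `` {u @ v}"
proof -
  have "R `` {u' @ v'} = R `` {u @ v}" if "(u, u') \<in> R" "(v, v') \<in> R" for u' v'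
    using class_eq_iff[OF hnn_rel.append[OF that]] by simp
  moreover have "(u, u) \<in> R" "(v, v) \<in> R"
    using assms by (auto intro: hnn_rel.refl)
  ultimately have "(\<Union>u'\<in>R `` {u}. \<Union>v'\<in>R `` {v}. R `` {u' @ v'}) = R `` {u @ v}"
    by blast
  then show ?thesis by (simp add: hnn_extension_def)
qed

lemma carrierE:
  assumes "U \<in> carrier H"
  obtains w where "w \<in> hnn_words G" "U = R `` {w}"
  using assms by (auto simp: hnn_extension_def elim: quotientE)

lemma one_class: "\<one>\<^bsub>H\<^esub> = R `` {[]}"
  by (simp add: hnn_extension_def)

lemma left_inverse:
  assumes "w \<in> hnn_words G"
  shows "\<exists>v \<in> hnn_words G. (v @ w, []) \<in> R"
  using assms
proof (induction w)
  case Nil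
  then show ?case by (auto intro!: bexI[of _ "[]"] hnn_rel.refl)
next
  case (Cons x w)
  then obtain v where v: "v \<in> hnn_words G" "(v @ w, []) \<in> R" by auto
  have "\<exists>y. [y] \<in> hnn_words G \<and> ([y, x], []) \<in> R"
  proof -
    consider (b) g where "x = Base g" "g \<in> carrier G" | (s) "x = Stable" | (i) "x = StableInv"
      using Cons.prems by auto
    then show ?thesis
    proof cases
      case b
      have "([Base (inv g), Base g], [Base \<one>]) \<in> R"
        using hnn_rel.base_mult[of "inv g" G g A \<phi>] b by simp
      then have "([Base (inv g), Base g], []) \<in> R"
        by (rule hnn_rel.trans) (rule hnn_rel.base_one)
      then show ?thesis using b by (intro exI[of _ "Base (inv g)"]) auto
    next
      case s
      then show ?thesis
        by (intro exI[of _ StableInv]) (auto intro: hnn_rel.stable_left)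
    next
      case i
      then show ?thesis
        by (intro exI[of _ Stable]) (auto intro: hnn_rel.stable_right)
    qed
  qed
  then obtain y where y: "[y] \<in> hnn_words G" "([y, x], []) \<in> R" by auto
  have "([y, x] @ w, [] @ w) \<in> R"
    using Cons.prems by (intro hnn_rel.append y hnn_rel.refl) auto
  then have "(v @ ([y, x] @ w), v @ ([] @ w)) \<in> R"
    using hnn_rel.append[OF hnn_rel.refl[OF v(1)]] by blast
  then have "((v @ [y]) @ x # w, v @ w) \<in> R" by simp
  then have "((v @ [y]) @ x # w, []) \<in> R"
    by (rule hnn_rel.trans) (rule v)
  moreover have "v @ [y] \<in> hnn_words G" using v y by auto
  ultimately show ?case by blast
qed

lemma group_hnn_extension: "group H"
proof (rule groupI)
  show "\<one>\<^bsub>H\<^esub> \<in> carrier H" by (simp add: one_class class_in_carrier)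
next
  fix U V assume "U \<in> carrier H" "V \<in> carrier H"
  then show "U \<otimes>\<^bsub>H\<^esub> V \<in> carrier H"
    by (elim carrierE) (simp add: class_mult class_in_carrier)
next
  fix U V W assume "U \<in> carrier H" "V \<in> carrier H" "W \<in> carrier H"
  then show "U \<otimes>\<^bsub>H\<^esub> V \<otimes>\<^bsub>H\<^esub> W = U \<otimes>\<^bsub>H\<^esub> (V \<otimes>\<^bsub>H\<^esub> W)"
    by (elim carrierE) (simp add: class_mult)
next
  fix U assume "U \<in> carrier H"
  then show "\<one>\<^bsub>H\<^esub> \<otimes>\<^bsub>H\<^esub> U = U"
    by (elim carrierE) (simp add: class_mult one_class)
next
  fix U assume "U \<in> carrier H"
  then obtain w where w: "w \<in> hnn_words G" "U = R `` {w}" by (rule carrierE)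
  then obtain v where v: "v \<in> hnn_words G" "(v @ w, []) \<in> R"
    using left_inverse by blast
  then have "R `` {v} \<otimes>\<^bsub>H\<^esub> U = \<one>\<^bsub>H\<^esub>"
    using w class_eq_iff[OF v(2)] by (simp add: class_mult one_class)
  then show "\<exists>V \<in> carrier H. V \<otimes>\<^bsub>H\<^esub> U = \<one>\<^bsub>H\<^esub>"
    using v class_in_carrier by blast
qed

lemma hnn_base_hom: "hnn_base G A \<phi> \<in> hom G H"
proof (rule homI)
  fix g h assume "g \<in> carrier G" "h \<in> carrier G"
  then show "hnn_base G A \<phi> (g \<otimes> h) = hnn_base G A \<phi> g \<otimes>\<^bsub>H\<^esub> hnn_base G A \<phi> h"
    using class_eq_iff[OF hnn_rel.base_mult[of g G h A \<phi>]]
    by (simp add: hnn_base_def class_mult)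
qed (simp add: hnn_base_def class_in_carrier)

lemma hnn_stable_closed: "hnn_stable G A \<phi> \<in> carrier H"
  by (simp add: hnn_stable_def class_in_carrier)

lemma inv_hnn_stable: "inv\<^bsub>H\<^esub> hnn_stable G A \<phi> = R `` {[StableInv]}"
proof -
  interpret H: group H by (rule group_hnn_extension)
  show ?thesis
    using class_eq_iff[OF hnn_rel.stable_left[of G A \<phi>]]
    by (intro H.inv_equality) (simp_all add: hnn_stable_def class_mult one_class class_in_carrier)
qed

lemma hnn_stable_conj:
  assumes "a \<in> A"
  shows "inv\<^bsub>H\<^esub> hnn_stable G A \<phi> \<otimes>\<^bsub>H\<^esub> hnn_base G A \<phi> a \<otimes>\<^bsub>H\<^esub> hnn_stable G A \<phi>
    = hnn_base G A \<phi> (\<phi> a)"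
  using class_eq_iff[OF hnn_rel.stable_conj[OF assms, where G = G and \<phi> = \<phi>]] assms A_sub
  unfolding inv_hnn_stable by (auto simp: hnn_stable_def hnn_base_def class_mult)

end

text \<open>The universal property of the presentation.\<close>

fun hnn_eval :: "('c, 'd) monoid_scheme \<Rightarrow> ('a \<Rightarrow> 'c) \<Rightarrow> 'c \<Rightarrow> 'a hnn_letter list \<Rightarrow> 'c" where
  "hnn_eval K f s [] = \<one>\<^bsub>K\<^esub>"
| "hnn_eval K f s (Base g # w) = f g \<otimes>\<^bsub>K\<^esub> hnn_eval K f s w"
| "hnn_eval K f s (Stable # w) = s \<otimes>\<^bsub>K\<^esub> hnn_eval K f s w"
| "hnn_eval K f s (StableInv # w) = inv\<^bsub>K\<^esub> s \<otimes>\<^bsub>K\<^esub> hnn_eval K f s w"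

context hnn_data
begin

context
  fixes K :: "('c, 'd) monoid_scheme" and f :: "'a \<Rightarrow> 'c" and s :: 'c
  assumes K: "group K" and f: "f \<in> hom G K" and s: "s \<in> carrier K"
    and conj: "\<And>a. a \<in> A \<Longrightarrow> inv\<^bsub>K\<^esub> s \<otimes>\<^bsub>K\<^esub> f a \<otimes>\<^bsub>K\<^esub> s = f (\<phi> a)"
begin

interpretation K: group K by (rule K)

lemma f_closed: "g \<in> carrier G \<Longrightarrow> f g \<in> carrier K"
  using f by (auto simp: hom_def)

lemma eval_closed: "w \<in> hnn_words G \<Longrightarrow> hnn_eval K f s w \<in> carrier K"
proof (induction w)
  case (Cons x w)
  then show ?case by (cases x) (auto simp: s f_closed)
qed simp

lemma eval_append: "u \<in> hnn_words G \<Longrightarrow> v \<in> hnn_words G \<Longrightarrow>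
    hnn_eval K f s (u @ v) = hnn_eval K f s u \<otimes>\<^bsub>K\<^esub> hnn_eval K f s v"
proof (induction u)
  case (Cons x u)
  then show ?case by (cases x) (auto simp: s f_closed eval_closed K.m_assoc)
qed (simp add: eval_closed)

lemma eval_rel: "(u, v) \<in> R \<Longrightarrow> hnn_eval K f s u = hnn_eval K f s v"
proof (induction rule: hnn_rel.induct)
  case (append u v u' v')
  then show ?case using rel_words by (metis eval_append)
next
  case base_one
  then show ?case using hom_one[OF f is_group K] by simp
next
  case (base_mult g h)
  then show ?case using f by (simp add: f_closed hom_mult K.m_assoc)
next
  case (stable_conj a)
  then show ?case using conj[of a] A_sub phi_closed[of a] s f_closed
    by (auto simp: K.m_assoc)
qed (simp_all add: s)

lemma universal_property:
  "\<exists>h \<in> hom H K. (\<forall>g \<in> carrier G. h (hnn_base G A \<phi> g) = f g) \<and> h (hnn_stable G A \<phi>) = s \<and>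
     (\<forall>h' \<in> hom H K. (\<forall>g \<in> carrier G. h' (hnn_base G A \<phi> g) = f g) \<and> h' (hnn_stable G A \<phi>) = s
        \<longrightarrow> (\<forall>x \<in> carrier H. h' x = h x))"
proof -
  define h where "h U = hnn_eval K f s (SOME w. w \<in> U)" for U
  have h: "h (R `` {w}) = hnn_eval K f s w" if "w \<in> hnn_words G" for w
  proof -
    have "w \<in> R `` {w}" using that by (auto intro: hnn_rel.refl)
    then have "(SOME v. v \<in> R `` {w}) \<in> R `` {w}" by (rule someI)
    then show ?thesis unfolding h_def using eval_rel by auto
  qed
  have "h \<in> hom H K"
  proof (rule homI)
    fix U assume "U \<in> carrier H"
    then show "h U \<in> carrier K" by (elim carrierE) (simp add: h eval_closed)
  next
    fix U V assume "U \<in> carrier H" "V \<in> carrier H"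
    then show "h (U \<otimes>\<^bsub>H\<^esub> V) = h U \<otimes>\<^bsub>K\<^esub> h V"
      by (elim carrierE) (simp add: h class_mult eval_append)
  qed
  moreover have "h (hnn_base G A \<phi> g) = f g" if "g \<in> carrier G" for g
    using that by (simp add: hnn_base_def h f_closed)
  moreover have "h (hnn_stable G A \<phi>) = s"
    by (simp add: hnn_stable_def h s)
  moreover have "h' x = h x" if h': "h' \<in> hom H K"
    and b: "\<forall>g \<in> carrier G. h' (hnn_base G A \<phi> g) = f g" and t: "h' (hnn_stable G A \<phi>) = s"
    and x: "x \<in> carrier H" for h' x
  proof -
    interpret h': group_hom H K h'
      using h' group_hnn_extension K by (simp add: group_hom_def group_hom_axioms_def)
    have "h' (R `` {w}) = hnn_eval K f s w" if "w \<in> hnn_words G" for w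
      using that
    proof (induction w)
      case Nil
      then show ?case using h'.hom_one by (simp add: one_class)
    next
      case (Cons y w)
      have y: "[y] \<in> hnn_words G" and w: "w \<in> hnn_words G" using Cons.prems by auto
      have "h' (R `` {y # w}) = h' (R `` {[y]}) \<otimes>\<^bsub>K\<^esub> hnn_eval K f s w"
        using class_mult[OF y w] h'.hom_mult[OF class_in_carrier[OF y] class_in_carrier[OF w]]
          Cons.IH[OF w] by simp
      moreover have "h' (R `` {[StableInv]}) = inv\<^bsub>K\<^esub> s"
        using h'.hom_inv[OF hnn_stable_closed] t inv_hnn_stable by simp
      ultimately show ?case
        using y b t by (cases y) (auto simp: hnn_base_def hnn_stable_def)
    qed
    then show ?thesis using x by (elim carrierE) (simp add: h)
  qed
  ultimately show ?thesis by blast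
qed

end

end

end

theory Submission
  imports Defs
begin

text \<open>
  The HNN-extension acts on its Bass-Serre tree, whose vertices are the cosets \<open>h G\<close> and whose edges
  lead from \<open>h G\<close> to \<open>h t G\<close>. At the vertex \<open>G\<close> the outgoing edges are stabilized by the conjugates of
  \<open>A\<close> and the incoming edges by the conjugates of \<open>B\<close>. Since \<open>A\<close> is malnormal and meets no conjugate of
  \<open>B\<close>, an outgoing edge and any other edge at the same vertex have no common nontrivial stabilizer
  element (\<open>hnn_edge_rigid\<close>). Hence the fixed subtree of a nontrivial element is empty or a star whose
  edges all point to its centre, and no nontrivial element fixes three consecutive edges.

  By \<open>CSA_star_group_iff\<close> the CSA* property can be tested on commuting elements: commutation is
  transitive on nontrivial elements, an element that commutes with its conjugate by \<open>g\<close> commutes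
  with \<open>g\<close>, and there are no involutions. Whether \<open>y\<close> has a fixed vertex decides between two cases.

  If it has one, elements commuting with \<open>y\<close> fix the centre of its star, and two commuting elements
  have the same centre, because an edge between two centres would have to be oriented both ways.
  So the question moves into the stabilizer of the centre, a copy of \<open>G\<close>.

  If it has none, \<open>y\<close> translates a line (\<open>axis_exists\<close>). Two lines translated by the same element
  coincide, since their distance is periodic but would grow without bound along one of them
  (\<open>periodic_lines_coincide\<close>). So elements commuting with \<open>y\<close> translate the same line and, acting
  faithfully on it, commute with each other. An element that conjugates \<open>y\<close> to an element commuting
  with \<open>y\<close> preserves the line; it is a translation, as a reflection would be an involution. This is
  \<open>csa_star_tree_action\<close>.

  That the coset graph is a tree (\<open>oriented_tree_hnn\<close>) comes from normal forms: words in \<open>G\<close> and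
  \<open>t\<^sup>\<plusminus>\<^sup>1\<close> act on normal forms compatibly with the defining relations, and the number of stable letters
  in the normal form of \<open>h\<^sup>-\<^sup>1 k\<close> is the distance between \<open>h G\<close> and \<open>k G\<close>.
\<close>

section \<open>Commutation in CSA-groups without involutions\<close>

text \<open>The CSA* property in terms of commuting elements. It is relativized to a set, since vertex
  stabilizers are subsets of the group that acts.\<close>

definition csa_star_on :: "('a, 'b) monoid_scheme \<Rightarrow> 'a set \<Rightarrow> bool" where
  "csa_star_on G S \<longleftrightarrow>
     (\<forall>x\<in>S. \<forall>y\<in>S. \<forall>z\<in>S. y \<noteq> \<one>\<^bsub>G\<^esub> \<longrightarrow> x \<otimes>\<^bsub>G\<^esub> y = y \<otimes>\<^bsub>G\<^esub> x \<longrightarrow> y \<otimes>\<^bsub>G\<^esub> z = z \<otimes>\<^bsub>G\<^esub> y \<longrightarrow>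
        x \<otimes>\<^bsub>G\<^esub> z = z \<otimes>\<^bsub>G\<^esub> x) \<and>
     (\<forall>x\<in>S. \<forall>g\<in>S. x \<noteq> \<one>\<^bsub>G\<^esub> \<longrightarrow>
        x \<otimes>\<^bsub>G\<^esub> (inv\<^bsub>G\<^esub> g \<otimes>\<^bsub>G\<^esub> x \<otimes>\<^bsub>G\<^esub> g) = (inv\<^bsub>G\<^esub> g \<otimes>\<^bsub>G\<^esub> x \<otimes>\<^bsub>G\<^esub> g) \<otimes>\<^bsub>G\<^esub> x \<longrightarrow>
        x \<otimes>\<^bsub>G\<^esub> g = g \<otimes>\<^bsub>G\<^esub> x) \<and>
     (\<forall>x\<in>S. x \<otimes>\<^bsub>G\<^esub> x = \<one>\<^bsub>G\<^esub> \<longrightarrow> x = \<one>\<^bsub>G\<^esub>)"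

context group
begin

lemma inv_mult_cancel_left:
  "x \<in> carrier G \<Longrightarrow> y \<in> carrier G \<Longrightarrow> inv x \<otimes> (x \<otimes> y) = y"
  by (simp add: m_assoc[symmetric])

lemma mult_inv_cancel_left:
  "x \<in> carrier G \<Longrightarrow> y \<in> carrier G \<Longrightarrow> x \<otimes> (inv x \<otimes> y) = y"
  by (simp add: m_assoc[symmetric])

lemma commutes_inv:
  assumes "x \<in> carrier G" "y \<in> carrier G" "x \<otimes> y = y \<otimes> x"
  shows "x \<otimes> inv y = inv y \<otimes> x"
proof -
  have "inv y \<otimes> (x \<otimes> y) \<otimes> inv y = inv y \<otimes> (y \<otimes> x) \<otimes> inv y"
    using assms by simp
  then show ?thesis
    using assms(1,2) by (simp add: m_assoc inv_mult_cancel_left)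
qed

lemma ord_two_iff:
  assumes "x \<in> carrier G"
  shows "ord x = 2 \<longleftrightarrow> x \<noteq> \<one> \<and> x \<otimes> x = \<one>"
proof -
  have "x [^] (2::nat) = x \<otimes> x"
    using assms by (simp add: numeral_2_eq_2)
  then have sq: "x \<otimes> x = \<one> \<longleftrightarrow> ord x dvd 2"
    using pow_eq_id[OF assms, of 2] by simp
  have "ord x = 1 \<longleftrightarrow> x = \<one>"
    using ord_eq_1[OF assms] by simp
  then show ?thesis
    using sq by (auto dest: primes_dvd_imp_eq prime_nat_iff[THEN iffD1, OF two_is_prime_nat, THEN conjunct2, rule_format])
qed

text \<open>By Zorn's lemma two commuting elements lie in a maximal set of pairwise commuting elements.
  Such a set is its own centralizer, hence a subgroup.\<close>

lemma commuting_pair_in_maximal_abelian: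
  assumes x: "x \<in> carrier G" and y: "y \<in> carrier G" and xy: "x \<otimes> y = y \<otimes> x"
  obtains M where "maximal_abelian_subgroup M G" "x \<in> M" "y \<in> M"
proof -
  define com where "com S \<longleftrightarrow> S \<subseteq> carrier G \<and> (\<forall>a\<in>S. \<forall>b\<in>S. a \<otimes> b = b \<otimes> a)" for S
  let ?F = "{S. com S \<and> {x, y} \<subseteq> S}"
  have "\<exists>M\<in>?F. \<forall>N\<in>?F. M \<subseteq> N \<longrightarrow> N = M"
  proof (rule subset_Zorn_nonempty)
    show "?F \<noteq> {}"
      using x y xy by (auto simp: com_def intro!: exI[of _ "{x, y}"])
  next
    fix C assume C: "C \<noteq> {}" "subset.chain ?F C"
    then have sub: "com S" "{x, y} \<subseteq> S" if "S \<in> C" for S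
      using that by (auto simp: subset.chain_def)
    have "a \<otimes> b = b \<otimes> a" if "a \<in> S" "S \<in> C" "b \<in> T" "T \<in> C" for a b S T
    proof -
      have "S \<subseteq> T \<or> T \<subseteq> S"
        using C(2) that by (auto simp: subset.chain_def)
      then show ?thesis
        using sub(1)[OF that(2)] sub(1)[OF that(4)] that by (auto simp: com_def)
    qed
    moreover have "\<Union>C \<subseteq> carrier G"
      using sub(1) unfolding com_def by blast
    moreover have "{x, y} \<subseteq> \<Union>C"
      using C(1) sub(2) by blast
    ultimately show "\<Union>C \<in> ?F"
      unfolding com_def by blast
  qed
  then obtain M where M: "com M" "x \<in> M" "y \<in> M"
    and max: "\<And>N. com N \<Longrightarrow> M \<subseteq> N \<Longrightarrow> N = M"
    by auto blast
  have MG: "M \<subseteq> carrier G" and Mc: "\<And>a b. a \<in> M \<Longrightarrow> b \<in> M \<Longrightarrow> a \<otimes> b = b \<otimes> a"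
    using M(1) by (auto simp: com_def)
  have cen: "z \<in> M" if "z \<in> carrier G" "\<And>a. a \<in> M \<Longrightarrow> z \<otimes> a = a \<otimes> z" for z
  proof -
    have "com (insert z M)"
      using that M(1) by (auto simp: com_def)
    from max[OF this] show ?thesis by auto
  qed
  have sg: "subgroup M G"
  proof
    show "M \<subseteq> carrier G" by (rule MG)
    show "\<one> \<in> M" by (rule cen) (use MG in auto)
    show "a \<otimes> b \<in> M" if "a \<in> M" "b \<in> M" for a b
    proof (rule cen)
      show "a \<otimes> b \<in> carrier G" using that MG by auto
      show "a \<otimes> b \<otimes> c = c \<otimes> (a \<otimes> b)" if "c \<in> M" for c
      proof -
        have c: "a \<in> carrier G" "b \<in> carrier G" "c \<in> carrier G"
          using MG that \<open>a \<in> M\<close> \<open>b \<in> M\<close> by auto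
        have "a \<otimes> b \<otimes> c = a \<otimes> (c \<otimes> b)"
          using Mc[OF \<open>b \<in> M\<close> that] c by (simp add: m_assoc)
        also have "\<dots> = c \<otimes> (a \<otimes> b)"
          using Mc[OF \<open>a \<in> M\<close> that] c by (simp flip: m_assoc)
        finally show ?thesis .
      qed
    qed
    show "inv a \<in> M" if "a \<in> M" for a
    proof (rule cen)
      show "inv a \<in> carrier G" using that MG by auto
      show "inv a \<otimes> c = c \<otimes> inv a" if "c \<in> M" for c
        using commutes_inv[of c a] Mc[OF that \<open>a \<in> M\<close>] subsetD[OF MG] that \<open>a \<in> M\<close>
        by metis
    qed
  qed
  have "comm_group (G\<lparr>carrier := M\<rparr>)"
    using Mc by (intro group.group_comm_groupI subgroup.subgroup_is_group[OF sg is_group]) auto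
  moreover have "N = M" if "abelian_subgroup N G" "M \<subseteq> N" for N
  proof (rule max)
    have cN: "comm_group (G\<lparr>carrier := N\<rparr>)" and "subgroup N G"
      using that by (auto simp: abelian_subgroup_def)
    have "comm_monoid (G\<lparr>carrier := N\<rparr>)"
      using cN by (rule comm_group.axioms)
    from comm_monoid.m_comm[OF this] \<open>subgroup N G\<close> show "com N"
      by (auto simp: com_def dest: subgroup.subset)
  qed (rule that(2))
  ultimately have "maximal_abelian_subgroup M G"
    using sg by (auto simp: maximal_abelian_subgroup_def abelian_subgroup_def)
  then show thesis
    using that M by blast
qed

end

text \<open>Malnormality of the maximal abelian subgroup through a pair of commuting elements gives the
  first two conditions. Conversely, under these conditions a nontrivial maximal abelian subgroup
  is the centralizer of each of its nontrivial elements.\<close>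

lemma CSA_star_group_iff:
  fixes G (structure)
  shows "CSA_star_group G \<longleftrightarrow> group G \<and> csa_star_on G (carrier G)"
proof
  assume CSA: "CSA_star_group G"
  then interpret group G by (simp add: CSA_star_group_def CSA_group_def)
  have mal: "g \<in> M" if M: "maximal_abelian_subgroup M G" and g: "g \<in> carrier G"
    and y: "y \<in> M" "y \<noteq> \<one>" "inv g \<otimes> y \<otimes> g \<in> M" for M g y
  proof (rule ccontr)
    assume "g \<notin> M"
    moreover have "malnormal M G"
      using CSA M by (auto simp: CSA_star_group_def CSA_group_def)
    ultimately have "M \<inter> conj_set G M g = {\<one>}"
      using g by (auto simp: malnormal_def)
    then have eq: "inv g \<otimes> y \<otimes> g = \<one>"
      using y by (auto simp: conj_set_def)
    have yG: "y \<in> carrier G"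
      using M y by (auto simp: maximal_abelian_subgroup_def abelian_subgroup_def subgroup_def)
    have "g \<otimes> (inv g \<otimes> y \<otimes> g) \<otimes> inv g = y"
      using g yG by (simp add: m_assoc mult_inv_cancel_left)
    then show False
      using eq g y(2) by simp
  qed
  have com: "a \<otimes> b = b \<otimes> a" if M: "maximal_abelian_subgroup M G" and "a \<in> M" "b \<in> M" for M a b
  proof -
    have "comm_monoid (G\<lparr>carrier := M\<rparr>)"
      using M by (auto simp: maximal_abelian_subgroup_def abelian_subgroup_def comm_group_def)
    from comm_monoid.m_comm[OF this] that show ?thesis by auto
  qed
  have 1: "x \<otimes> z = z \<otimes> x"
    if c: "x \<in> carrier G" "y \<in> carrier G" "z \<in> carrier G" and "y \<noteq> \<one>" "x \<otimes> y = y \<otimes> x"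
      and yz: "y \<otimes> z = z \<otimes> y" for x y z
  proof -
    obtain M where M: "maximal_abelian_subgroup M G" "x \<in> M" "y \<in> M"
      by (rule commuting_pair_in_maximal_abelian[OF c(1,2) \<open>x \<otimes> y = y \<otimes> x\<close>])
    have "inv z \<otimes> y \<otimes> z = y"
      using c yz by (simp add: m_assoc inv_mult_cancel_left)
    then have "z \<in> M"
      using mal[OF M(1)] that M by metis
    then show ?thesis using com[OF M(1)] M by metis
  qed
  have 2: "x \<otimes> g = g \<otimes> x"
    if c: "x \<in> carrier G" "g \<in> carrier G" and "x \<noteq> \<one>"
      and com_conj: "x \<otimes> (inv g \<otimes> x \<otimes> g) = (inv g \<otimes> x \<otimes> g) \<otimes> x" for x g
  proof -
    have "inv g \<otimes> x \<otimes> g \<in> carrier G" using c by simp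
    then obtain M where M: "maximal_abelian_subgroup M G" "x \<in> M" "inv g \<otimes> x \<otimes> g \<in> M"
      by (rule commuting_pair_in_maximal_abelian[OF c(1) _ com_conj])
    then have "g \<in> M" using mal that by metis
    then show ?thesis using com[OF M(1)] M by metis
  qed
  have 3: "x = \<one>" if "x \<in> carrier G" "x \<otimes> x = \<one>" for x
    using CSA that ord_two_iff[of x] by (auto simp: CSA_star_group_def)
  show "group G \<and> csa_star_on G (carrier G)"
    unfolding csa_star_on_def using 1 2 3 is_group by blast
next
  assume asm: "group G \<and> csa_star_on G (carrier G)"
  then interpret group G by simp
  have tr: "x \<otimes> z = z \<otimes> x"
    if "x \<in> carrier G" "y \<in> carrier G" "z \<in> carrier G" "y \<noteq> \<one>" "x \<otimes> y = y \<otimes> x"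
      "y \<otimes> z = z \<otimes> y" for x y z
    using asm that unfolding csa_star_on_def by blast
  have cj: "x \<otimes> g = g \<otimes> x"
    if "x \<in> carrier G" "g \<in> carrier G" "x \<noteq> \<one>"
      "x \<otimes> (inv g \<otimes> x \<otimes> g) = (inv g \<otimes> x \<otimes> g) \<otimes> x" for x g
    using asm that unfolding csa_star_on_def by blast
  have "malnormal M G" if M: "maximal_abelian_subgroup M G" for M
  proof -
    have sg: "subgroup M G" and cm: "comm_monoid (G\<lparr>carrier := M\<rparr>)"
      and max: "\<And>N. abelian_subgroup N G \<Longrightarrow> M \<subseteq> N \<Longrightarrow> N = M"
      using M by (auto simp: maximal_abelian_subgroup_def abelian_subgroup_def comm_group_def)
    have com: "a \<otimes> b = b \<otimes> a" if "a \<in> M" "b \<in> M" for a b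
      using comm_monoid.m_comm[OF cm] that by auto
    have MG: "a \<in> carrier G" if "a \<in> M" for a
      using sg that by (rule subgroup.mem_carrier)
    have "g \<in> M" if g: "g \<in> carrier G" and y: "y \<in> M" "y \<noteq> \<one>" and gy: "inv g \<otimes> y \<otimes> g \<in> M" for g y
    proof -
      have "g \<otimes> y = y \<otimes> g"
        using cj[of y g] com[OF y(1) gy] g y MG by metis
      then obtain N where N: "maximal_abelian_subgroup N G" "g \<in> N" "y \<in> N"
        by (rule commuting_pair_in_maximal_abelian[OF g MG[OF y(1)]])
      moreover have "M \<subseteq> N"
      proof
        fix a assume a: "a \<in> M"
        have "subgroup N G" and cN: "comm_monoid (G\<lparr>carrier := N\<rparr>)"
          and maxN: "\<And>K. abelian_subgroup K G \<Longrightarrow> N \<subseteq> K \<Longrightarrow> K = N"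
          using N(1) by (auto simp: maximal_abelian_subgroup_def abelian_subgroup_def comm_group_def)
        let ?C = "{c \<in> carrier G. c \<otimes> y = y \<otimes> c}"
        have comC: "b \<otimes> c = c \<otimes> b" if "b \<in> ?C" "c \<in> ?C" for b c
          using tr[of b y c] that y MG by auto
        have "subgroup ?C G"
        proof
          show "b \<otimes> c \<in> ?C" if "b \<in> ?C" "c \<in> ?C" for b c
          proof -
            have "b \<otimes> c \<otimes> y = b \<otimes> (y \<otimes> c)"
              using that y MG by (auto simp: m_assoc)
            also have "\<dots> = y \<otimes> (b \<otimes> c)"
              using that y MG by (auto simp flip: m_assoc)
            finally show ?thesis using that by auto
          qed
          show "inv b \<in> ?C" if "b \<in> ?C" for b
            using that commutes_inv[of y b] MG[OF y(1)] by auto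
        qed (use y MG in auto)
        then have "abelian_subgroup ?C G"
          using comC unfolding abelian_subgroup_def
          by (auto intro!: group.group_comm_groupI subgroup.subgroup_is_group is_group)
        moreover have "N \<subseteq> ?C"
          using comm_monoid.m_comm[OF cN] N(3) \<open>subgroup N G\<close> by (auto dest: subgroup.mem_carrier)
        ultimately have "?C = N" by (rule maxN)
        then show "a \<in> N" using a y com MG by auto
      qed
      ultimately show "g \<in> M"
        using max[of N] by (simp add: maximal_abelian_subgroup_def)
    qed
    then have "M \<inter> conj_set G M g \<subseteq> {\<one>}" if "g \<in> carrier G - M" for g
      using that by (force simp: conj_set_def)
    moreover have "\<one> \<in> M \<inter> conj_set G M g" if "g \<in> carrier G - M" for g
      using that subgroup.one_closed[OF sg] by (auto simp: conj_set_def intro!: exI[of _ \<one>])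
    ultimately show "malnormal M G"
      using sg by (auto simp: malnormal_def)
  qed
  moreover have "ord x \<noteq> 2" if "x \<in> carrier G" for x
    using asm that ord_two_iff[of x] unfolding csa_star_on_def by blast
  ultimately show "CSA_star_group G"
    using is_group by (simp add: CSA_star_group_def CSA_group_def)
qed

text \<open>Vertex stabilizers are conjugates of an embedded copy of the base group and inherit its
  commutation properties in this way.\<close>

lemma csa_star_on_image:
  assumes "group G" "group K" "f \<in> hom G K" "inj_on f (carrier G)" "csa_star_on G (carrier G)"
  shows "csa_star_on K (f ` carrier G)"
proof -
  interpret group_hom G K f
    using assms by (simp add: group_hom_def group_hom_axioms_def)
  have inj: "f a = f b \<longleftrightarrow> a = b" if "a \<in> carrier G" "b \<in> carrier G" for a b
    using assms(4) that by (auto dest: inj_onD)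
  have one: "f a = \<one>\<^bsub>K\<^esub> \<longleftrightarrow> a = \<one>\<^bsub>G\<^esub>" if "a \<in> carrier G" for a
    using inj[OF that G.one_closed] by simp
  have com: "f a \<otimes>\<^bsub>K\<^esub> f b = f b \<otimes>\<^bsub>K\<^esub> f a \<longleftrightarrow> a \<otimes>\<^bsub>G\<^esub> b = b \<otimes>\<^bsub>G\<^esub> a"
    if "a \<in> carrier G" "b \<in> carrier G" for a b
    using that inj[of "a \<otimes>\<^bsub>G\<^esub> b" "b \<otimes>\<^bsub>G\<^esub> a"] by simp
  have conj: "inv\<^bsub>K\<^esub> f b \<otimes>\<^bsub>K\<^esub> f a \<otimes>\<^bsub>K\<^esub> f b = f (inv\<^bsub>G\<^esub> b \<otimes>\<^bsub>G\<^esub> a \<otimes>\<^bsub>G\<^esub> b)"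
    if "a \<in> carrier G" "b \<in> carrier G" for a b
    using that by simp
  show ?thesis
    unfolding csa_star_on_def
  proof (intro conjI ballI impI; elim imageE; hypsubst)
    fix a b c
    assume c: "a \<in> carrier G" "b \<in> carrier G" "c \<in> carrier G"
    assume "f b \<noteq> \<one>\<^bsub>K\<^esub>" "f a \<otimes>\<^bsub>K\<^esub> f b = f b \<otimes>\<^bsub>K\<^esub> f a" "f b \<otimes>\<^bsub>K\<^esub> f c = f c \<otimes>\<^bsub>K\<^esub> f b"
    then have "b \<noteq> \<one>\<^bsub>G\<^esub>" "a \<otimes>\<^bsub>G\<^esub> b = b \<otimes>\<^bsub>G\<^esub> a" "b \<otimes>\<^bsub>G\<^esub> c = c \<otimes>\<^bsub>G\<^esub> b"
      using c com one by blast+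
    then show "f a \<otimes>\<^bsub>K\<^esub> f c = f c \<otimes>\<^bsub>K\<^esub> f a"
      using c com[of a c] assms(5) unfolding csa_star_on_def by blast
  next
    fix a b
    assume c: "a \<in> carrier G" "b \<in> carrier G"
    assume "f a \<noteq> \<one>\<^bsub>K\<^esub>"
      "f a \<otimes>\<^bsub>K\<^esub> (inv\<^bsub>K\<^esub> f b \<otimes>\<^bsub>K\<^esub> f a \<otimes>\<^bsub>K\<^esub> f b) = (inv\<^bsub>K\<^esub> f b \<otimes>\<^bsub>K\<^esub> f a \<otimes>\<^bsub>K\<^esub> f b) \<otimes>\<^bsub>K\<^esub> f a"
    then have "a \<noteq> \<one>\<^bsub>G\<^esub>"
      "a \<otimes>\<^bsub>G\<^esub> (inv\<^bsub>G\<^esub> b \<otimes>\<^bsub>G\<^esub> a \<otimes>\<^bsub>G\<^esub> b) = (inv\<^bsub>G\<^esub> b \<otimes>\<^bsub>G\<^esub> a \<otimes>\<^bsub>G\<^esub> b) \<otimes>\<^bsub>G\<^esub> a"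
      unfolding conj[OF c] using c com[of a "inv\<^bsub>G\<^esub> b \<otimes>\<^bsub>G\<^esub> a \<otimes>\<^bsub>G\<^esub> b"] one by auto
    then show "f a \<otimes>\<^bsub>K\<^esub> f b = f b \<otimes>\<^bsub>K\<^esub> f a"
      using c com[of a b] assms(5) unfolding csa_star_on_def by blast
  next
    fix a
    assume c: "a \<in> carrier G" and "f a \<otimes>\<^bsub>K\<^esub> f a = \<one>\<^bsub>K\<^esub>"
    then have "a \<otimes>\<^bsub>G\<^esub> a = \<one>\<^bsub>G\<^esub>"
      using one[of "a \<otimes>\<^bsub>G\<^esub> a"] by simp
    then have "a = \<one>\<^bsub>G\<^esub>"
      using c assms(5) unfolding csa_star_on_def by blast
    then show "f a = \<one>\<^bsub>K\<^esub>"
      by simp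
  qed
qed

section \<open>Lines in trees\<close>

text \<open>A tree enters through its oriented edges and its graph metric: for two distinct vertices
  \<open>u\<close> and \<open>w\<close> exactly one neighbour of \<open>u\<close> is closer to \<open>w\<close>, all others are one step further.
  These conditions force \<open>d\<close> to be the number of edges of a shortest walk and exclude circuits.\<close>

locale oriented_tree =
  fixes V :: "'v set" and E :: "('v \<times> 'v) set" and d :: "'v \<Rightarrow> 'v \<Rightarrow> nat"
  assumes edge_closed: "(u, v) \<in> E \<Longrightarrow> u \<in> V \<and> v \<in> V"
    and edge_asym: "(u, v) \<in> E \<Longrightarrow> (v, u) \<notin> E"
    and dist_zero_iff: "u \<in> V \<Longrightarrow> w \<in> V \<Longrightarrow> d u w = 0 \<longleftrightarrow> u = w"
    and dist_step: "(u, p) \<in> E \<union> E\<inverse> \<Longrightarrow> w \<in> V \<Longrightarrow> d p w = Suc (d u w) \<or> d u w = Suc (d p w)"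
    and closer_exists: "u \<in> V \<Longrightarrow> w \<in> V \<Longrightarrow> u \<noteq> w \<Longrightarrow> \<exists>p. (u, p) \<in> E \<union> E\<inverse> \<and> d p w < d u w"
    and closer_unique: "w \<in> V \<Longrightarrow> (u, p) \<in> E \<union> E\<inverse> \<Longrightarrow> (u, q) \<in> E \<union> E\<inverse> \<Longrightarrow>
      d p w < d u w \<Longrightarrow> d q w < d u w \<Longrightarrow> p = q"
begin

abbreviation adj :: "'v \<Rightarrow> 'v \<Rightarrow> bool" where
  "adj u v \<equiv> (u, v) \<in> E \<union> E\<inverse>"

lemma adj_sym: "adj u v \<Longrightarrow> adj v u"
  by auto

lemma adj_closed: "adj u v \<Longrightarrow> u \<in> V \<and> v \<in> V"
  using edge_closed by auto

lemma not_closer: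
  assumes "w \<in> V" "adj u q" "\<not> d q w < d u w"
  shows "d q w = Suc (d u w)"
  using dist_step[OF assms(2,1)] assms(3) by auto

lemma dist_le_walk: "(u, w) \<in> (E \<union> E\<inverse>) ^^ n \<Longrightarrow> w \<in> V \<Longrightarrow> d u w \<le> n"
proof (induction n arbitrary: u)
  case 0
  then show ?case using dist_zero_iff by auto
next
  case (Suc n)
  then obtain p where p: "adj u p" "(p, w) \<in> (E \<union> E\<inverse>) ^^ n"
    by (blast dest: relpow_Suc_D2)
  then have "d p w \<le> n" using Suc by blast
  then show ?case using dist_step[OF p(1) \<open>w \<in> V\<close>] by auto
qed

lemma dist_walk: "u \<in> V \<Longrightarrow> w \<in> V \<Longrightarrow> (u, w) \<in> (E \<union> E\<inverse>) ^^ d u w"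
proof (induction "d u w" arbitrary: u)
  case 0
  then have "u = w" using dist_zero_iff by metis
  then show ?case using 0 by (metis relpow_0_I)
next
  case (Suc n)
  then have "u \<noteq> w" using dist_zero_iff by (metis nat.distinct(1))
  then obtain p where p: "adj u p" "d p w < d u w"
    using closer_exists Suc by blast
  then have "n = d p w" using dist_step[OF p(1) \<open>w \<in> V\<close>] Suc(2) by auto
  then have "(p, w) \<in> (E \<union> E\<inverse>) ^^ n"
    using Suc(1)[OF _ _ \<open>w \<in> V\<close>] adj_closed[OF p(1)] by blast
  then show ?case using p(1) unfolding Suc(2)[symmetric] by (blast intro: relpow_Suc_I2)
qed

lemma walk_sym: "(u, w) \<in> (E \<union> E\<inverse>) ^^ n \<Longrightarrow> (w, u) \<in> (E \<union> E\<inverse>) ^^ n"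
proof (induction n arbitrary: u)
  case (Suc n)
  then obtain p where p: "adj u p" "(p, w) \<in> (E \<union> E\<inverse>) ^^ n"
    by (blast dest: relpow_Suc_D2)
  then show ?case using Suc.IH[OF p(2)] adj_sym[OF p(1)] by (blast intro: relpow_Suc_I)
qed simp

text \<open>Symmetry and the triangle inequality hold because \<open>d\<close> is the length of a shortest walk, and
  walks can be reversed and concatenated.\<close>

lemma dist_sym:
  assumes "u \<in> V" "w \<in> V"
  shows "d u w = d w u"
  using assms dist_le_walk[OF walk_sym[OF dist_walk]] by (metis antisym)

lemma dist_triangle:
  assumes "u \<in> V" "v \<in> V" "w \<in> V"
  shows "d u w \<le> d u v + d v w"
  using dist_le_walk[of u w "d u v + d v w"] relcompI[OF dist_walk[OF assms(1,2)] dist_walk[OF assms(2,3)]]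
    assms(3) by (simp add: relpow_add)

definition line :: "(int \<Rightarrow> 'v) \<Rightarrow> bool" where
  "line L \<longleftrightarrow> (\<forall>i. adj (L i) (L (i + 1)) \<and> L (i - 1) \<noteq> L (i + 1))"

lemma line_adj: "line L \<Longrightarrow> adj (L i) (L (i + 1))"
  by (simp add: line_def)

lemma line_no_backtrack: "line L \<Longrightarrow> L (i - 1) \<noteq> L (i + 1)"
  by (simp add: line_def)

lemma line_in_V: "line L \<Longrightarrow> L i \<in> V"
  using line_adj adj_closed by blast

lemma line_reverse:
  assumes "line L"
  shows "line (\<lambda>i. L (- i))"
  unfolding line_def
proof (intro allI conjI)
  fix i
  show "adj (L (- i)) (L (- (i + 1)))"
    using adj_sym[OF line_adj[OF assms, of "- (i + 1)"]] by simp
  show "L (- (i - 1)) \<noteq> L (- (i + 1))"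
    using not_sym[OF line_no_backtrack[OF assms, of "- i"]] by (simp add: minus_diff_eq)
qed

text \<open>Once a line moves away from a vertex \<open>w\<close> it does so forever, because the only closer
  neighbour is the one it comes from.\<close>

lemma line_escapes:
  assumes L: "line L" and w: "w \<in> V" and less: "d (L (i - 1)) w < d (L i) w"
  shows "d (L (i + int n)) w = d (L i) w + n"
proof -
  have up: "d (L (j + 1)) w = Suc (d (L j) w)" if "d (L (j - 1)) w < d (L j) w" for j
  proof (rule not_closer[OF w line_adj[OF L]])
    show "\<not> d (L (j + 1)) w < d (L j) w"
      using closer_unique[OF w adj_sym[OF line_adj[OF L, of "j - 1"]], of "L (j + 1)"]
        line_adj[OF L, of j] line_no_backtrack[OF L, of j] that by auto
  qed
  have "d (L (i + int n)) w = d (L i) w + n \<and> d (L (i + int n - 1)) w < d (L (i + int n)) w"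
  proof (induction n)
    case (Suc n)
    then show ?case using up[of "i + int n"] by (simp add: algebra_simps)
  qed (use less in simp)
  then show ?thesis ..
qed

lemma line_dist_nat:
  assumes L: "line L"
  shows "d (L (i + int n)) (L i) = n"
proof (cases n)
  case (Suc k)
  have z: "d (L i) (L i) = 0" using dist_zero_iff line_in_V[OF L] by blast
  then have "d (L (i + 1)) (L i) = 1"
    using dist_step[OF line_adj[OF L, of i] line_in_V[OF L, of i]] by auto
  then show ?thesis
    using line_escapes[OF L line_in_V[OF L, of i], of "i + 1" k] z Suc by (simp add: algebra_simps)
qed (use dist_zero_iff line_in_V[OF L] in simp)

lemma line_dist:
  assumes L: "line L"
  shows "d (L i) (L j) = nat \<bar>i - j\<bar>"
proof (cases "j \<le> i")
  case True
  then show ?thesis using line_dist_nat[OF L, of j "nat (i - j)"] by simp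
next
  case False
  then show ?thesis
    using line_dist_nat[OF L, of i "nat (j - i)"] dist_sym line_in_V[OF L] by simp
qed

lemma line_inj:
  assumes "line L"
  shows "L i = L j \<longleftrightarrow> i = j"
proof
  assume "L i = L j"
  then have "d (L i) (L j) = 0" using dist_zero_iff line_in_V[OF assms] by simp
  then show "i = j" using line_dist[OF assms] by simp
qed simp

text \<open>From its least value the distance to \<open>w\<close> grows along the line in both directions, by
  \<open>line_escapes\<close>.\<close>

lemma line_projection:
  assumes L: "line L" and w: "w \<in> V"
  obtains m where "\<And>i. d (L i) w = d (L m) w + nat \<bar>i - m\<bar>"
proof -
  obtain m where m: "\<And>i. d (L m) w \<le> d (L i) w"
    using ex_has_least_nat[of "\<lambda>_. True" 0 "\<lambda>i. d (L i) w"] by auto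
  have up: "d (K (k + int n)) w = d (K k) w + n"
    if K: "line K" and min: "\<And>i. d (K k) w \<le> d (K i) w" for K k n
  proof (cases n)
    case (Suc j)
    have "d (K (k + 1)) w = Suc (d (K k) w)"
      using not_closer[OF w line_adj[OF K, of k]] min[of "k + 1"] by simp
    then show ?thesis
      using line_escapes[OF K w, of "k + 1" j] Suc by (simp add: algebra_simps)
  qed simp
  have "d (L i) w = d (L m) w + nat \<bar>i - m\<bar>" for i
  proof (cases "m \<le> i")
    case True
    then show ?thesis using up[OF L m, of "nat (i - m)"] by simp
  next
    case False
    then show ?thesis
      using up[OF line_reverse[OF L], of "- m" "nat (m - i)"] m by simp
  qed
  then show thesis by (rule that)
qed

definition line_dist_to :: "(int \<Rightarrow> 'v) \<Rightarrow> 'v \<Rightarrow> nat" where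
  "line_dist_to L v = Inf (range (\<lambda>i. d (L i) v))"

lemma line_dist_to_eq:
  assumes "\<And>i. d (L i) w = d (L m) w + nat \<bar>i - m\<bar>"
  shows "line_dist_to L w = d (L m) w"
  unfolding line_dist_to_def
proof (rule cInf_eq_minimum)
  show "d (L m) w \<in> range (\<lambda>i. d (L i) w)" by blast
  show "d (L m) w \<le> x" if "x \<in> range (\<lambda>i. d (L i) w)" for x
    using that by clarify (subst assms, simp)
qed

text \<open>The step from \<open>v\<close> towards its projection approaches all points of the line at once, so any
  other step moves away from all of them.\<close>

lemma line_dist_to_increases:
  assumes L: "line L" and v: "v \<in> V" and off: "line_dist_to L v > 0"
  obtains p where "\<And>q. adj v q \<Longrightarrow> q \<noteq> p \<Longrightarrow> line_dist_to L q = Suc (line_dist_to L v)"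
proof -
  obtain m where m: "\<And>i. d (L i) v = d (L m) v + nat \<bar>i - m\<bar>"
    using line_projection[OF L v] by metis
  have dv: "line_dist_to L v = d (L m) v" by (rule line_dist_to_eq[OF m])
  have LV: "L i \<in> V" for i using L by (rule line_in_V)
  have "v \<noteq> L m" using off dv dist_zero_iff[OF LV[of m] v] by auto
  then obtain p where p: "adj v p" "d p (L m) < d v (L m)"
    using closer_exists[OF v LV] by blast
  have pV: "p \<in> V" using adj_closed p(1) by blast
  have p_closer: "d p (L j) < d v (L j)" for j
    using dist_triangle[OF pV LV[of m] LV[of j]] p(2) m[of j] line_dist[OF L, of m j]
      dist_sym[OF v LV, of j] dist_sym[OF v LV, of m] by (simp add: abs_minus_commute)
  have "line_dist_to L q = Suc (line_dist_to L v)" if q: "adj v q" "q \<noteq> p" for q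
  proof -
    have qV: "q \<in> V" using adj_closed q(1) by blast
    have "d q (L j) = Suc (d v (L j))" for j
      using not_closer[OF LV q(1)] closer_unique[OF LV p(1) q(1) p_closer] q(2) by metis
    then have Lq: "d (L j) q = Suc (d (L j) v)" for j
      using dist_sym[OF qV LV] dist_sym[OF v LV] by simp
    have "d (L i) q = d (L m) q + nat \<bar>i - m\<bar>" for i
      using m[of i] Lq by simp
    then show ?thesis
      using line_dist_to_eq[of L q m] Lq[of m] dv by metis
  qed
  then show thesis by (rule that)
qed

text \<open>At a point of \<open>L'\<close> farthest from \<open>L\<close>, one of the two neighbours on \<open>L'\<close> would be farther
  still, unless that point is on \<open>L\<close>.\<close>

lemma line_subset_of_bounded:
  assumes L: "line L" and L': "line L'" and bd: "\<And>i. line_dist_to L (L' i) \<le> N"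
  shows "range L' \<subseteq> range L"
proof -
  obtain i0 where i0: "\<And>i. line_dist_to L (L' i) \<le> line_dist_to L (L' i0)"
    using ex_has_greatest_nat[of "\<lambda>_. True" 0 "\<lambda>i. line_dist_to L (L' i)" "Suc N"] bd
    by (auto simp: less_Suc_eq_le)
  have z: "line_dist_to L (L' i0) = 0"
  proof (rule ccontr)
    assume "line_dist_to L (L' i0) \<noteq> 0"
    then obtain p where
      p: "\<And>q. adj (L' i0) q \<Longrightarrow> q \<noteq> p \<Longrightarrow> line_dist_to L q = Suc (line_dist_to L (L' i0))"
      using line_dist_to_increases[OF L line_in_V[OF L', of i0]] by auto
    have "adj (L' i0) (L' (i0 - 1))" "adj (L' i0) (L' (i0 + 1))"
      using adj_sym[OF line_adj[OF L', of "i0 - 1"]] line_adj[OF L', of i0] by simp_all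
    then have "L' (i0 - 1) = p" "L' (i0 + 1) = p"
      using p i0 Suc_n_not_le_n by metis+
    then show False using line_no_backtrack[OF L', of i0] by simp
  qed
  show ?thesis
  proof clarify
    fix i
    obtain m where m: "\<And>j. d (L j) (L' i) = d (L m) (L' i) + nat \<bar>j - m\<bar>"
      using line_projection[OF L line_in_V[OF L', of i]] by metis
    have "d (L m) (L' i) = 0"
      using line_dist_to_eq[OF m] i0[of i] z by simp
    then show "L' i \<in> range L"
      using dist_zero_iff line_in_V[OF L] line_in_V[OF L'] by (metis rangeI)
  qed
qed

lemma nonbacktracking_int:
  fixes \<sigma> :: "int \<Rightarrow> int"
  assumes "\<And>i. \<bar>\<sigma> (i + 1) - \<sigma> i\<bar> = 1" "\<And>i. \<sigma> (i - 1) \<noteq> \<sigma> (i + 1)"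
  shows "\<sigma> i = \<sigma> 0 + (\<sigma> 1 - \<sigma> 0) * i"
proof -
  have step: "\<sigma> (i + 1) - \<sigma> i = \<sigma> i - \<sigma> (i - 1)" for i
    using assms(1)[of i] assms(1)[of "i - 1"] assms(2)[of i] by (simp add: algebra_simps abs_if split: if_splits)
  have diff: "\<sigma> (i + 1) - \<sigma> i = \<sigma> 1 - \<sigma> 0" for i
  proof (induction i rule: int_induct[where k = 0])
    case (step1 i)
    then show ?case using step[of "i + 1"] by simp
  next
    case (step2 i)
    then show ?case using step[of i] by simp
  qed simp
  show ?thesis
  proof (induction i rule: int_induct[where k = 0])
    case (step1 i)
    then show ?case using diff[of i] by (simp add: algebra_simps)
  next
    case (step2 i)
    then show ?case using diff[of "i - 1"] by (simp add: algebra_simps)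
  qed simp
qed

lemma line_reparametrize:
  assumes L: "line L" and L': "line L'" and sub: "range L' \<subseteq> range L"
  obtains c e where "e = 1 \<or> e = - 1" "\<And>i. L' i = L (c + e * i)"
proof -
  have "\<forall>i. \<exists>j. L' i = L j" using sub by blast
  then obtain \<sigma> where \<sigma>: "\<And>i. L' i = L (\<sigma> i)" by metis
  have 1: "\<bar>\<sigma> (i + 1) - \<sigma> i\<bar> = 1" for i
    using line_dist[OF L', of "i + 1" i] line_dist[OF L, of "\<sigma> (i + 1)" "\<sigma> i"] unfolding \<sigma> by simp
  have 2: "\<sigma> (i - 1) \<noteq> \<sigma> (i + 1)" for i
    using line_no_backtrack[OF L', of i] \<sigma> by metis
  have "L' i = L (\<sigma> 0 + (\<sigma> 1 - \<sigma> 0) * i)" for i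
    using nonbacktracking_int[of \<sigma> i] 1 2 \<sigma> by metis
  moreover have "\<sigma> 1 - \<sigma> 0 = 1 \<or> \<sigma> 1 - \<sigma> 0 = - 1"
    using 1[of 0] by (auto simp: abs_if split: if_splits)
  ultimately show thesis by (rule that[rotated])
qed

end

lemma periodic_int_bounded:
  fixes f :: "int \<Rightarrow> nat"
  assumes "l > 0" "\<And>i. f (i + l) = f i"
  shows "\<exists>N. \<forall>i. f i \<le> N"
proof -
  have "f (i + l * k) = f i" for i k
  proof (induction k rule: int_induct[where k = 0])
    case (step1 k)
    then show ?case using assms(2)[of "i + l * k"] by (simp add: algebra_simps)
  next
    case (step2 k)
    then show ?case using assms(2)[of "i + l * (k - 1)"] by (simp add: algebra_simps)
  qed simp
  then have "f i = f (i mod l)" for i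
    by (metis mod_mult_div_eq)
  moreover have "i mod l \<in> {0..<l}" for i
    using assms(1) by simp
  ultimately have "f i \<le> Max (f ` {0..<l})" for i
    by (metis Max_ge finite_atLeastLessThan_int finite_imageI imageI)
  then show ?thesis by blast
qed

section \<open>Groups acting on trees with small edge stabilizers\<close>

text \<open>The group preserves the orientation of the edges, so it inverts no edge. The assumption
  \<open>edge_rigid\<close> says that at the source \<open>u\<close> of an edge \<open>(u, v)\<close> no nontrivial element fixes \<open>v\<close> together
  with another neighbour of \<open>u\<close>. Every path of three edges has its middle edge starting at one of the
  two inner vertices, so its pointwise stabilizer is trivial.\<close>

locale tree_action = oriented_tree V E d + group G
  for G :: "('a, 'b) monoid_scheme" (structure) and V :: "'v set" and E d +
  fixes act :: "'a \<Rightarrow> 'v \<Rightarrow> 'v"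
  assumes V_nonempty: "V \<noteq> {}"
    and act_closed: "g \<in> carrier G \<Longrightarrow> v \<in> V \<Longrightarrow> act g v \<in> V"
    and act_one: "v \<in> V \<Longrightarrow> act \<one> v = v"
    and act_mult: "g \<in> carrier G \<Longrightarrow> h \<in> carrier G \<Longrightarrow> v \<in> V \<Longrightarrow> act (g \<otimes> h) v = act g (act h v)"
    and act_edge: "g \<in> carrier G \<Longrightarrow> (u, v) \<in> E \<Longrightarrow> (act g u, act g v) \<in> E"
    and act_dist: "g \<in> carrier G \<Longrightarrow> u \<in> V \<Longrightarrow> v \<in> V \<Longrightarrow> d (act g u) (act g v) = d u v"
    and edge_rigid: "x \<in> carrier G \<Longrightarrow> (u, v) \<in> E \<Longrightarrow> (u, w) \<in> E \<union> E\<inverse> \<Longrightarrow> w \<noteq> v \<Longrightarrow>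
      act x u = u \<Longrightarrow> act x v = v \<Longrightarrow> act x w = w \<Longrightarrow> x = \<one>"
    and csa_stabilizer: "v \<in> V \<Longrightarrow> csa_star_on G {g \<in> carrier G. act g v = v}"
begin

lemma act_adj: "g \<in> carrier G \<Longrightarrow> adj u v \<Longrightarrow> adj (act g u) (act g v)"
  using act_edge by auto

lemma act_inv_act: "g \<in> carrier G \<Longrightarrow> v \<in> V \<Longrightarrow> act (inv g) (act g v) = v"
  by (metis act_mult act_one inv_closed l_inv)

lemma act_act_inv: "g \<in> carrier G \<Longrightarrow> v \<in> V \<Longrightarrow> act g (act (inv g) v) = v"
  by (metis act_mult act_one inv_closed r_inv)

lemma act_commute:
  "g \<in> carrier G \<Longrightarrow> h \<in> carrier G \<Longrightarrow> g \<otimes> h = h \<otimes> g \<Longrightarrow> v \<in> V \<Longrightarrow>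
    act g (act h v) = act h (act g v)"
  by (metis act_mult)

lemma act_inj: "g \<in> carrier G \<Longrightarrow> u \<in> V \<Longrightarrow> v \<in> V \<Longrightarrow> act g u = act g v \<longleftrightarrow> u = v"
  by (metis act_inv_act)

text \<open>The fixed vertices of a group element form a subtree: the first step from one of them
  towards another is unique, hence fixed as well.\<close>

lemma fixes_closer:
  assumes x: "x \<in> carrier G" and u: "u \<in> V" "act x u = u" and w: "w \<in> V" "act x w = w"
    and ne: "u \<noteq> w"
  obtains p where "adj u p" "act x p = p" "d p w < d u w"
proof -
  obtain p where p: "adj u p" "d p w < d u w"
    using closer_exists u w ne by blast
  have "adj u (act x p)"
    using act_adj[OF x p(1)] u by simp
  moreover have "d (act x p) w < d u w"
    using act_dist[OF x, of p w] adj_closed[OF p(1)] w p(2) by simp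
  ultimately have "act x p = p"
    using closer_unique w(1) p by blast
  then show thesis using that p by blast
qed

section \<open>Elements with a fixed vertex\<close>

text \<open>A nontrivial element that fixes a vertex fixes a star all of whose edges point to its
  centre, because two fixed edges never share the source of one of them.\<close>

definition centre :: "'a \<Rightarrow> 'v \<Rightarrow> bool" where
  "centre y c \<longleftrightarrow> c \<in> V \<and> act y c = c \<and>
     (\<forall>u v. (u, v) \<in> E \<longrightarrow> act y u = u \<longrightarrow> act y v = v \<longrightarrow> v = c)"

lemma centre_exists:
  assumes y: "y \<in> carrier G" "y \<noteq> \<one>" and v: "v \<in> V" "act y v = v"
  shows "\<exists>c. centre y c"
proof (cases "\<exists>u c. (u, c) \<in> E \<and> act y u = u \<and> act y c = c")
  case False
  then show ?thesis using v unfolding centre_def by blast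
next
  case True
  then obtain u c where uc: "(u, c) \<in> E" "act y u = u" "act y c = c" by blast
  have c: "c \<in> V" using edge_closed uc(1) by blast
  have "v' = c" if e: "(u', v') \<in> E" "act y u' = u'" "act y v' = v'" for u' v'
  proof (rule ccontr)
    assume ne: "v' \<noteq> c"
    have v': "v' \<in> V" using edge_closed e(1) by blast
    obtain p where p: "adj c p" "act y p = p" "d p v' < d c v'"
      using fixes_closer[OF y(1) c uc(3) v' e(3)] ne by metis
    have pc: "(p, c) \<in> E"
      using edge_rigid[OF y(1), of c p u] uc y(2) p by auto
    have only: "q = c" if "adj p q" "act y q = q" for q
      using edge_rigid[OF y(1) pc] that p(2) uc(3) y(2) by blast
    show False
    proof (cases "p = v'")
      case True
      then have "u' = c" using only e adj_sym by blast
      then show False using edge_asym[OF pc] e(1) True by simp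
    next
      case False
      then obtain q where "adj p q" "act y q = q" "d q v' < d p v'"
        using fixes_closer[OF y(1) _ p(2) v' e(3)] adj_closed[OF p(1)] by metis
      then show False using only[of q] p(3) by auto
    qed
  qed
  then show ?thesis using c uc(3) unfolding centre_def by blast
qed

text \<open>The path from a fixed vertex to the centre is fixed, so all its edges point to the centre and
  there is only one of them.\<close>

lemma centre_adjacent:
  assumes x: "x \<in> carrier G" and c: "centre x c" and v: "v \<in> V" "act x v = v" "v \<noteq> c"
  shows "(v, c) \<in> E"
proof -
  have cV: "c \<in> V" and cx: "act x c = c"
    and head: "\<And>u w. (u, w) \<in> E \<Longrightarrow> act x u = u \<Longrightarrow> act x w = w \<Longrightarrow> w = c"
    using c unfolding centre_def by blast+
  obtain p where p: "adj c p" "act x p = p" "d p v < d c v"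
    using fixes_closer[OF x cV cx v(1,2)] v(3) by metis
  have pc: "(p, c) \<in> E" using p head[of c p] cx by auto
  have "p = v"
  proof (rule ccontr)
    assume "p \<noteq> v"
    then obtain q where q: "adj p q" "act x q = q" "d q v < d p v"
      using fixes_closer[OF x _ p(2) v(1,2)] adj_closed[OF p(1)] by metis
    have "(q, p) \<in> E \<longrightarrow> p = c" "(p, q) \<in> E \<longrightarrow> q = c" using head q p by blast+
    then show False using q p pc edge_asym[OF pc] by auto
  qed
  then show ?thesis using pc by simp
qed

text \<open>An edge between two different centres would have to point both ways.\<close>

lemma centre_unique:
  assumes "x \<in> carrier G" "y \<in> carrier G" "centre x c" "centre y c'" "act x c' = c'" "act y c = c"
  shows "c = c'"
proof (rule ccontr)
  assume ne: "c \<noteq> c'"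
  have "c \<in> V" "c' \<in> V" using assms unfolding centre_def by auto
  then have "(c', c) \<in> E" "(c, c') \<in> E"
    using assms ne centre_adjacent[of x c c'] centre_adjacent[of y c' c] by auto
  then show False using edge_asym by blast
qed

lemma centre_conj:
  assumes y: "y \<in> carrier G" and h: "h \<in> carrier G" and c: "centre y c"
  shows "centre (inv h \<otimes> y \<otimes> h) (act (inv h) c)"
proof -
  have cV: "c \<in> V" and cy: "act y c = c"
    and head: "\<And>u w. (u, w) \<in> E \<Longrightarrow> act y u = u \<Longrightarrow> act y w = w \<Longrightarrow> w = c"
    using c unfolding centre_def by blast+
  have a: "act (inv h \<otimes> y \<otimes> h) v = act (inv h) (act y (act h v))" if "v \<in> V" for v
    using that y h by (simp add: act_mult act_closed m_assoc)
  have fix_iff: "act (inv h \<otimes> y \<otimes> h) v = v \<longleftrightarrow> act y (act h v) = act h v" if "v \<in> V" for v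
    using that y h a by (metis act_act_inv act_closed act_inv_act)
  show ?thesis
    unfolding centre_def
  proof (intro conjI allI impI)
    show V: "act (inv h) c \<in> V" using h cV act_closed by simp
    show "act (inv h \<otimes> y \<otimes> h) (act (inv h) c) = act (inv h) c"
      using fix_iff[OF V] act_act_inv[OF h cV] cy by simp
    fix u v assume e: "(u, v) \<in> E" "act (inv h \<otimes> y \<otimes> h) u = u" "act (inv h \<otimes> y \<otimes> h) v = v"
    then have "u \<in> V" "v \<in> V" using edge_closed by blast+
    then have "act h v = c"
      using head[OF act_edge[OF h e(1)]] fix_iff e by blast
    then show "v = act (inv h) c" using act_inv_act[OF h \<open>v \<in> V\<close>] by simp
  qed
qed

lemma commuting_fixes_centre:
  assumes y: "y \<in> carrier G" and z: "z \<in> carrier G" "y \<otimes> z = z \<otimes> y" and c: "centre y c"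
  shows "act z c = c"
proof -
  have "inv z \<otimes> y \<otimes> z = y"
    using y z by (simp add: m_assoc inv_mult_cancel_left)
  then have c': "centre y (act (inv z) c)"
    using centre_conj[OF y z(1) c] by simp
  then have "c = act (inv z) c"
    using centre_unique[OF y y c c'] c c' unfolding centre_def by blast
  then show ?thesis
    using act_act_inv[OF z(1), of c] c unfolding centre_def by metis
qed

section \<open>Elements without a fixed vertex\<close>

text \<open>An axis: the translates of a shortest path from a least displaced vertex to its image fit
  together without backtracking. At a backtracking the next vertex of the path would be displaced
  less, or an edge would be inverted.\<close>

lemma axis_exists:
  assumes y: "y \<in> carrier G" and free: "\<And>v. v \<in> V \<Longrightarrow> act y v \<noteq> v"
  obtains L l where "line L" "l > 0" "\<And>i. act y (L i) = L (i + l)"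
proof -
  obtain v where v: "v \<in> V" and vmin: "\<And>w. w \<in> V \<Longrightarrow> d v (act y v) \<le> d w (act y w)"
    using ex_has_least_nat[of "\<lambda>v. v \<in> V" _ "\<lambda>v. d v (act y v)"] V_nonempty by blast
  define n where "n = d v (act y v)"
  have yv: "act y v \<in> V" using act_closed y v by blast
  have npos: "n > 0" using free[OF v] dist_zero_iff[OF v yv] n_def by auto
  have "(v, act y v) \<in> (E \<union> E\<inverse>) ^^ n"
    using dist_walk[OF v yv] n_def by simp
  then obtain p where p: "p 0 = v" "p n = act y v" "\<And>k. k < n \<Longrightarrow> adj (p k) (p (Suc k))"
    unfolding relpow_fun_conv by blast
  have walk: "(p i, p (i + k)) \<in> (E \<union> E\<inverse>) ^^ k" if "i + k \<le> n" for i k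
    unfolding relpow_fun_conv using that p(3) by (intro exI[of _ "\<lambda>j. p (i + j)"]) auto
  have pV: "p k \<in> V" if "k \<le> n" for k
  proof (cases "k = n")
    case False
    then show ?thesis using adj_closed[OF p(3)[of k]] that by simp
  qed (simp add: p yv)
  have pdist: "d (p i) (p (i + k)) \<le> k" if "i + k \<le> n" for i k
    using dist_le_walk[OF walk[OF that] pV[OF that]] .
  have inner: "p k \<noteq> p (k + 2)" if k: "k + 2 \<le> n" for k
  proof
    assume eq: "p k = p (k + 2)"
    have "n = d (p 0) (p n)" using n_def p by simp
    also have "\<dots> \<le> d (p 0) (p k) + d (p k) (p n)"
      using dist_triangle pV k by simp
    also have "\<dots> \<le> k + (n - (k + 2))"
      using pdist[of 0 k] pdist[of "k + 2" "n - (k + 2)", unfolded le_add_diff_inverse[OF k]] k eq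
      by (intro add_mono) auto
    finally show False using k by simp
  qed
  have turn: "p (n - 1) \<noteq> act y (p 1)"
  proof
    assume eq: "p (n - 1) = act y (p 1)"
    show False
    proof (cases "n = 1")
      case True
      \<comment> \<open>Then \<open>y\<close> exchanges the two ends of an edge, against the orientation.\<close>
      have "p 1 = act y v" "act y (p 1) = v"
        using p eq True by auto
      moreover have "adj v (p 1)" using p(1) p(3)[of 0] True by simp
      ultimately show False
        using act_edge[OF y, of v "p 1"] act_edge[OF y, of "p 1" v] edge_asym by auto
    next
      case False
      then have "d (p 1) (p (1 + (n - 2))) \<le> n - 2"
        using npos by (intro pdist) auto
      moreover have "1 + (n - 2) = n - 1" using False npos by simp
      ultimately have "d (p 1) (act y (p 1)) \<le> n - 2"
        using eq by simp
      moreover have "n \<le> d (p 1) (act y (p 1))"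
        using vmin[OF pV[of 1]] npos n_def by simp
      ultimately show False using npos by simp
    qed
  qed
  define l where "l = int n"
  have lpos: "l > 0" using npos l_def by simp
  define L where "L i = act (y [^] (i div l)) (p (nat (i mod l)))" for i
  have pow: "y [^] (q::int) \<in> carrier G" for q using y by simp
  have pow_Suc: "y [^] (q + 1) = y [^] q \<otimes> y" "y [^] (q + 1) = y \<otimes> y [^] q" for q :: int
    using int_pow_mult[OF y, of q 1] int_pow_mult[OF y, of 1 q] y by (simp_all add: int_pow_1 add.commute)
  have L_eq: "L (q * l + int k) = act (y [^] q) (p k)" if k: "k \<le> n" for q k
  proof (cases "k = n")
    case True
    have "(q * l + int k) div l = q + 1" "(q * l + int k) mod l = 0"
      using True lpos l_def by auto
    then have "L (q * l + int k) = act (y [^] (q + 1)) v"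
      using p(1) by (simp add: L_def)
    also have "\<dots> = act (y [^] q) (p k)"
      using pow_Suc(1) act_mult[OF pow y v] p(2) True by simp
    finally show ?thesis .
  next
    case False
    then have "(q * l + int k) div l = q" "(q * l + int k) mod l = int k"
      using k lpos l_def by auto
    then show ?thesis by (simp add: L_def)
  qed
  have decomp: "\<exists>q k. i = q * l + int k \<and> k < n" for i
    using lpos l_def by (intro exI[of _ "i div l"] exI[of _ "nat (i mod l)"]) (auto simp: nat_less_iff)
  have "line L"
    unfolding line_def
  proof (intro allI conjI)
    fix i
    obtain q k where k: "i = q * l + int k" "k < n" using decomp by blast
    then show "adj (L i) (L (i + 1))"
      using L_eq[of k q] L_eq[of "Suc k" q] act_adj[OF pow p(3)[of k]] by (simp add: algebra_simps)
  next
    fix i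
    obtain q k where k: "i - 1 = q * l + int k" "k < n" using decomp by blast
    have Lm: "L (i - 1) = act (y [^] q) (p k)" using L_eq[of k q] k by simp
    show "L (i - 1) \<noteq> L (i + 1)"
    proof (cases "k + 2 \<le> n")
      case True
      have "L (i + 1) = act (y [^] q) (p (k + 2))"
        using L_eq[of "k + 2" q] True k by (simp add: algebra_simps)
      then show ?thesis
        using Lm inner[OF True] act_inj[OF pow pV pV] True by simp
    next
      case False
      then have kn: "k = n - 1" using k by simp
      have "i + 1 = (q + 1) * l + int 1"
        using k kn npos l_def by (simp add: algebra_simps of_nat_diff)
      then have "L (i + 1) = act (y [^] (q + 1)) (p 1)"
        using L_eq[of 1 "q + 1"] npos by simp
      also have "\<dots> = act (y [^] q) (act y (p 1))"
        using pow_Suc(1) act_mult[OF pow y pV] npos by simp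
      finally show ?thesis
        using Lm turn kn act_inj[OF pow pV act_closed[OF y pV], of "n - 1" 1] npos by simp
    qed
  qed
  moreover have "act y (L i) = L (i + l)" for i
  proof -
    obtain q k where k: "i = q * l + int k" "k < n" using decomp by blast
    have "L (i + l) = act (y [^] (q + 1)) (p k)"
      using L_eq[of k "q + 1"] k by (simp add: algebra_simps)
    also have "\<dots> = act y (act (y [^] q) (p k))"
      using pow_Suc(2) act_mult[OF y pow pV] k by simp
    finally show ?thesis using L_eq[of k q] k by simp
  qed
  ultimately show thesis using lpos by (intro that)
qed

lemma line_act: "line L \<Longrightarrow> g \<in> carrier G \<Longrightarrow> line (\<lambda>i. act g (L i))"
  unfolding line_def
proof (intro allI conjI)
  fix i
  assume L: "\<forall>i. adj (L i) (L (i + 1)) \<and> L (i - 1) \<noteq> L (i + 1)" and g: "g \<in> carrier G"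
  then show "adj (act g (L i)) (act g (L (i + 1)))" using act_adj by blast
  have "L j \<in> V" for j using L adj_closed by blast
  then show "act g (L (i - 1)) \<noteq> act g (L (i + 1))" using L act_inj[OF g] by blast
qed

text \<open>The distance to \<open>L\<close> is periodic along \<open>L'\<close>, hence bounded.\<close>

lemma periodic_lines_coincide:
  assumes y: "y \<in> carrier G" and L: "line L" "\<And>i. act y (L i) = L (i + k)"
    and L': "line L'" "\<And>i. act y (L' i) = L' (i + l)" "l > 0"
  obtains c e where "e = 1 \<or> e = - 1" "\<And>i. L' i = L (c + e * i)"
proof -
  have "line_dist_to L (act y v) = line_dist_to L v" if v: "v \<in> V" for v
  proof -
    have "d (L i) (act y v) = d (L (i - k)) v" for i
      using act_dist[OF y line_in_V[OF L(1)] v, of "i - k"] L(2)[of "i - k"] by simp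
    then have "range (\<lambda>i. d (L i) (act y v)) = (\<lambda>i. d (L i) v) ` range (\<lambda>i. i - k)"
      by (simp only: image_image)
    moreover have "range (\<lambda>i. i - k) = UNIV"
      by (rule surjI[of _ "\<lambda>i. i + k"]) simp
    ultimately show ?thesis by (simp add: line_dist_to_def)
  qed
  then have "line_dist_to L (L' (i + l)) = line_dist_to L (L' i)" for i
    using L'(2) line_in_V[OF L'(1)] by metis
  then obtain N where "\<And>i. line_dist_to L (L' i) \<le> N"
    using periodic_int_bounded[OF L'(3), of "\<lambda>i. line_dist_to L (L' i)"] by blast
  then have "range L' \<subseteq> range L"
    by (rule line_subset_of_bounded[OF L(1) L'(1)])
  then show thesis
    using line_reparametrize[OF L(1) L'(1)] that by metis
qed

text \<open>Three consecutive edges of the line suffice, by the orientation of the middle one.\<close>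

lemma fixes_line_trivial:
  assumes x: "x \<in> carrier G" and L: "line L" and "\<And>i. act x (L i) = L i"
  shows "x = \<one>"
proof -
  have "adj (L 1) (L 2)" "adj (L 1) (L 0)" "adj (L 2) (L 3)" "L 0 \<noteq> L 2" "L 3 \<noteq> L 1"
    using line_adj[OF L, of 1] adj_sym[OF line_adj[OF L, of 0]] line_adj[OF L, of 2]
      line_inj[OF L] by simp_all
  then show ?thesis
    using edge_rigid[OF x, of "L 1" "L 2" "L 0"] edge_rigid[OF x, of "L 2" "L 1" "L 3"] assms(3)
    by auto
qed

lemma determined_on_line:
  assumes "x \<in> carrier G" "z \<in> carrier G" and L: "line L" and eq: "\<And>i. act x (L i) = act z (L i)"
  shows "x = z"
proof -
  have "act (inv z \<otimes> x) (L i) = L i" for i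
    using assms act_mult[of "inv z" x "L i"] act_inv_act[of z "L i"] line_in_V[OF L, of i] by simp
  then have "inv z \<otimes> x = \<one>"
    using fixes_line_trivial[OF _ L] assms by simp
  then show ?thesis
    using assms by (metis inv_equality inv_closed inv_inv)
qed

lemma translations_commute:
  assumes x: "x \<in> carrier G" and z: "z \<in> carrier G" and L: "line L"
    and "\<And>i. act x (L i) = L (i + a)" "\<And>i. act z (L i) = L (i + b)"
  shows "x \<otimes> z = z \<otimes> x"
proof (rule determined_on_line[OF _ _ L])
  show "act (x \<otimes> z) (L i) = act (z \<otimes> x) (L i)" for i
    using assms(4)[of "i + b"] assms(4)[of i] assms(5)[of "i + a"] assms(5)[of i]
      act_mult[OF x z line_in_V[OF L, of i]] act_mult[OF z x line_in_V[OF L, of i]]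
    by (simp add: add.commute add.left_commute)
qed (use x z in auto)

text \<open>The image of the axis under \<open>x\<close> is again an axis of \<open>y\<close>, so \<open>x\<close> preserves the axis. A reflection would
  conjugate the translation \<open>y\<close> to its inverse.\<close>

lemma commuting_translates_axis:
  assumes y: "y \<in> carrier G" and L: "line L" "l > 0" "\<And>i. act y (L i) = L (i + l)"
    and x: "x \<in> carrier G" "x \<otimes> y = y \<otimes> x"
  obtains c where "\<And>i. act x (L i) = L (i + c)"
proof -
  have LV: "L i \<in> V" for i using L(1) by (rule line_in_V)
  have yx: "act y (act x (L i)) = act x (L (i + l))" for i
    using act_commute[OF x(1) y x(2) LV] L(3) by simp
  then obtain c e where e: "e = 1 \<or> e = - 1" and xL: "\<And>i. act x (L i) = L (c + e * i)"
    using periodic_lines_coincide[OF y L(1,3) line_act[OF L(1) x(1)], of l] L(2) by metis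
  have "L (c + l) = L (c + e * l)"
    using yx[of 0] xL[of 0] xL[of l] L(3)[of c] by simp
  then have "e = 1" using e L(2) line_inj[OF L(1)] by auto
  then show thesis using that[of c] xL by (simp add: add.commute)
qed

text \<open>Everything that commutes with \<open>y\<close> fixes the centre of \<open>y\<close> or translates its axis. If \<open>x\<close>
  commutes with its conjugate by \<open>g\<close>, then both have the same centre or the same axis, and \<open>g\<close>
  preserves it. On an axis \<open>g\<close> is a translation like \<open>x\<close>: a reflection has trivial square, and there are
  no involutions because an element without a fixed vertex translates an axis.\<close>

theorem csa_star_tree_action: "csa_star_on G (carrier G)"
proof -
  have stab_trans: "x \<otimes> z = z \<otimes> x"
    if "v \<in> V" "x \<in> carrier G" "y \<in> carrier G" "z \<in> carrier G" "act x v = v" "act y v = v" "act z v = v"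
      "y \<noteq> \<one>" "x \<otimes> y = y \<otimes> x" "y \<otimes> z = z \<otimes> y" for v x y z
    using csa_stabilizer[OF that(1)] that unfolding csa_star_on_def by blast
  have stab_conj: "x \<otimes> g = g \<otimes> x"
    if "v \<in> V" "x \<in> carrier G" "g \<in> carrier G" "act x v = v" "act g v = v" "x \<noteq> \<one>"
      "x \<otimes> (inv g \<otimes> x \<otimes> g) = (inv g \<otimes> x \<otimes> g) \<otimes> x" for v x g
    using csa_stabilizer[OF that(1)] that unfolding csa_star_on_def by blast
  have stab_sq: "x = \<one>" if "v \<in> V" "x \<in> carrier G" "act x v = v" "x \<otimes> x = \<one>" for v x
    using csa_stabilizer[OF that(1)] that unfolding csa_star_on_def by blast
  have sq: "x = \<one>" if x: "x \<in> carrier G" "x \<otimes> x = \<one>" for x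
  proof (cases "\<exists>v\<in>V. act x v = v")
    case True
    then show ?thesis using stab_sq x by blast
  next
    case False
    then obtain L l where L: "line L" "l > 0" "\<And>i. act x (L i) = L (i + l)"
      using axis_exists[OF x(1)] by metis
    have "L (0 + l + l) = L 0"
      using L(3) act_mult[OF x(1) x(1) line_in_V[OF L(1)], of 0] x(2) act_one[OF line_in_V[OF L(1)], of 0]
      by metis
    then show ?thesis using line_inj[OF L(1)] L(2) by simp
  qed
  have tr: "x \<otimes> z = z \<otimes> x"
    if x: "x \<in> carrier G" and y: "y \<in> carrier G" "y \<noteq> \<one>" and z: "z \<in> carrier G"
      and xy: "x \<otimes> y = y \<otimes> x" and yz: "y \<otimes> z = z \<otimes> y" for x y z
  proof (cases "\<exists>v\<in>V. act y v = v")
    case True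
    then obtain c where c: "centre y c" using centre_exists y by blast
    then have "c \<in> V" "act y c = c" "act x c = c" "act z c = c"
      using commuting_fixes_centre[OF y(1) x _ c] commuting_fixes_centre[OF y(1) z yz c] xy
      unfolding centre_def by auto
    then show ?thesis using stab_trans x y z xy yz by blast
  next
    case False
    then obtain L l where L: "line L" "l > 0" "\<And>i. act y (L i) = L (i + l)"
      using axis_exists[OF y(1)] by metis
    obtain a b where "\<And>i. act x (L i) = L (i + a)" "\<And>i. act z (L i) = L (i + b)"
      using commuting_translates_axis[OF y(1) L x xy] commuting_translates_axis[OF y(1) L z yz[symmetric]]
      by metis
    then show ?thesis using translations_commute[OF x z L(1)] by blast
  qed
  have cj: "x \<otimes> g = g \<otimes> x"
    if x: "x \<in> carrier G" "x \<noteq> \<one>" and g: "g \<in> carrier G"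
      and com: "x \<otimes> (inv g \<otimes> x \<otimes> g) = (inv g \<otimes> x \<otimes> g) \<otimes> x" for x g
  proof -
    define x' where "x' = inv g \<otimes> x \<otimes> g"
    have x': "x' \<in> carrier G" using x g x'_def by simp
    have xx': "x \<otimes> x' = x' \<otimes> x" using com x'_def by simp
    show ?thesis
    proof (cases "\<exists>v\<in>V. act x v = v")
      case True
      then obtain c where c: "centre x c" using centre_exists x by blast
      have c': "centre x' (act (inv g) c)"
        unfolding x'_def by (rule centre_conj[OF x(1) g c])
      have "c = act (inv g) c"
        using centre_unique[OF x(1) x' c c'] commuting_fixes_centre[OF x(1) x' xx' c]
          commuting_fixes_centre[OF x' x(1) xx'[symmetric] c'] by simp
      then have "act g c = c"
        using act_act_inv[OF g, of c] c unfolding centre_def by metis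
      then show ?thesis
        using stab_conj x g com c unfolding centre_def by blast
    next
      case False
      then obtain L l where L: "line L" "l > 0" "\<And>i. act x (L i) = L (i + l)"
        using axis_exists[OF x(1)] by metis
      have LV: "L i \<in> V" for i using L(1) by (rule line_in_V)
      have ig: "inv g \<in> carrier G" using g by simp
      obtain k where k: "\<And>i. act x' (L i) = L (i + k)"
        using commuting_translates_axis[OF x(1) L x' xx'[symmetric]] by metis
      have "x' \<otimes> inv g = inv g \<otimes> x"
        using x g by (simp add: x'_def m_assoc)
      then have "act x' (act (inv g) (L i)) = act (inv g) (L (i + l))" for i
        using act_mult[OF x' ig LV] act_mult[OF ig x(1) LV] L(3) by metis
      then obtain c e where e: "e = 1 \<or> e = - 1" and gL: "\<And>i. act (inv g) (L i) = L (c + e * i)"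
        using periodic_lines_coincide[OF x' L(1) k line_act[OF L(1) ig], of l] L(2) by metis
      have "x \<otimes> inv g = inv g \<otimes> x"
        using e
      proof
        assume "e = 1"
        then show ?thesis
          using translations_commute[OF x(1) ig L(1) L(3), of c] gL by (simp add: add.commute)
      next
        assume "e = - 1"
        then have "act (inv g \<otimes> inv g) (L i) = L i" for i
          using gL act_mult[OF ig ig LV] by simp
        then have "inv g \<otimes> inv g = \<one>"
          using fixes_line_trivial[OF _ L(1)] ig by simp
        then have "inv g = \<one>" using sq ig by blast
        then show ?thesis using x by simp
      qed
      then show ?thesis
        using commutes_inv[OF x(1) ig] g by simp
    qed
  qed
  show ?thesis
    unfolding csa_star_on_def using tr cj sq by blast
qed

end

section \<open>Normal forms in HNN-extensions\<close>

locale hnn_iso = group G for G (structure) +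
  fixes A B :: "'a set" and \<phi> :: "'a \<Rightarrow> 'a"
  assumes A: "subgroup A G" and B: "subgroup B G"
    and iso: "\<phi> \<in> iso (G\<lparr>carrier := A\<rparr>) (G\<lparr>carrier := B\<rparr>)"
begin

lemma phi_bij: "bij_betw \<phi> A B"
  using iso by (simp add: iso_def)

lemma phi_hom: "a \<in> A \<Longrightarrow> b \<in> A \<Longrightarrow> \<phi> (a \<otimes> b) = \<phi> a \<otimes> \<phi> b"
  using iso by (simp add: iso_def hom_def)

end

sublocale hnn_iso \<subseteq> hnn_data G A \<phi>
proof
  show "A \<subseteq> carrier G" using A by (rule subgroup.subset)
  show "\<phi> a \<in> carrier G" if "a \<in> A" for a
    using that phi_bij B by (meson bij_betwE subgroup.mem_carrier)
qed

sublocale hnn_iso \<subseteq> ext: group "hnn_extension G A \<phi>"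
  by (rule group_hnn_extension)

datatype 'a normal_form = Tail 'a | Syllable 'a bool "'a normal_form"

primrec syllables :: "'a normal_form \<Rightarrow> nat" where
  "syllables (Tail g) = 0"
| "syllables (Syllable r e n) = Suc (syllables n)"

context hnn_iso
begin

text \<open>Both signs of the stable letter are treated at once: \<open>True\<close> stands for \<open>t\<close> and \<open>False\<close> for
  \<open>t\<^sup>-\<^sup>1\<close>. In the extension \<open>a t = t \<phi>(a)\<close> for \<open>a \<in> A\<close>, and \<open>b t\<^sup>-\<^sup>1 = t\<^sup>-\<^sup>1 \<phi>\<^sup>-\<^sup>1(b)\<close> for \<open>b \<in> B\<close>.\<close>

definition assoc_sub :: "bool \<Rightarrow> 'a set" where
  "assoc_sub e = (if e then A else B)"

definition assoc_iso :: "bool \<Rightarrow> 'a \<Rightarrow> 'a" where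
  "assoc_iso e = (if e then \<phi> else the_inv_into A \<phi>)"

lemma assoc_sub: "subgroup (assoc_sub e) G"
  by (simp add: assoc_sub_def A B)

lemma assoc_sub_closed: "a \<in> assoc_sub e \<Longrightarrow> a \<in> carrier G"
  using assoc_sub by (rule subgroup.mem_carrier)

lemma assoc_iso_closed: "a \<in> assoc_sub e \<Longrightarrow> assoc_iso e a \<in> assoc_sub (\<not> e)"
  using phi_bij bij_betw_the_inv_into[OF phi_bij]
  by (auto simp: assoc_sub_def assoc_iso_def dest: bij_betwE)

lemma assoc_iso_carrier: "a \<in> assoc_sub e \<Longrightarrow> assoc_iso e a \<in> carrier G"
  by (rule assoc_sub_closed[OF assoc_iso_closed])

lemma assoc_iso_inverse: "a \<in> assoc_sub e \<Longrightarrow> assoc_iso (\<not> e) (assoc_iso e a) = a"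
  using phi_bij
  by (auto simp: assoc_sub_def assoc_iso_def bij_betw_def the_inv_into_f_f f_the_inv_into_f)

lemma assoc_iso_mult:
  assumes "a \<in> assoc_sub e" "b \<in> assoc_sub e"
  shows "assoc_iso e (a \<otimes> b) = assoc_iso e a \<otimes> assoc_iso e b"
proof (cases e)
  case True
  then show ?thesis using assms by (simp add: assoc_sub_def assoc_iso_def phi_hom)
next
  case False
  let ?a = "assoc_iso e a" and ?b = "assoc_iso e b"
  have ab: "?a \<in> A" "?b \<in> A" using assoc_iso_closed[of a e] assoc_iso_closed[of b e] assms False
    by (simp_all add: assoc_sub_def)
  have "\<phi> ?a = a" "\<phi> ?b = b"
    using assoc_iso_inverse[OF assms(1)] assoc_iso_inverse[OF assms(2)] False
    by (simp_all add: assoc_iso_def)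
  then have "\<phi> (?a \<otimes> ?b) = a \<otimes> b" using phi_hom[OF ab] by simp
  moreover have "?a \<otimes> ?b \<in> A" using ab A by (auto dest: subgroup.m_closed)
  ultimately show ?thesis
    using phi_bij False by (metis assoc_iso_def bij_betw_def the_inv_into_f_f)
qed

lemma assoc_iso_one: "assoc_iso e \<one> = \<one>"
proof -
  have "\<one> \<in> assoc_sub e" using assoc_sub by (rule subgroup.one_closed)
  then have "assoc_iso e \<one> \<otimes> assoc_iso e \<one> = assoc_iso e \<one>" "assoc_iso e \<one> \<in> carrier G"
    using assoc_iso_mult[of \<one> e \<one>] assoc_iso_carrier by auto
  then show ?thesis by (metis l_cancel_one')
qed

text \<open>The subgroup itself must be represented by \<open>\<one>\<close>, so that a cancellation of stable letters shows
  up as the representative \<open>\<one>\<close> between opposite signs.\<close>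

definition rep :: "bool \<Rightarrow> 'a \<Rightarrow> 'a" where
  "rep e g = (if g \<in> assoc_sub e then \<one> else SOME r. r \<in> g <# assoc_sub e)"

lemma rep_in_coset: "g \<in> carrier G \<Longrightarrow> rep e g \<in> g <# assoc_sub e"
proof (cases "g \<in> assoc_sub e")
  case True
  then have "inv g \<in> assoc_sub e" using subgroup.m_inv_closed[OF assoc_sub] by blast
  then show ?thesis
    using True assoc_sub_closed[OF True] by (force simp: rep_def l_coset_def)
next
  case False
  assume "g \<in> carrier G"
  then have "g \<in> g <# assoc_sub e" by (rule lcos_self[OF _ assoc_sub])
  then show ?thesis using False by (auto simp: rep_def intro: someI)
qed

lemma rep_closed: "g \<in> carrier G \<Longrightarrow> rep e g \<in> carrier G"
  using rep_in_coset l_coset_carrier[OF _ _ assoc_sub] by blast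

lemma rep_rest: "g \<in> carrier G \<Longrightarrow> inv (rep e g) \<otimes> g \<in> assoc_sub e"
proof -
  assume g: "g \<in> carrier G"
  then obtain a where a: "a \<in> assoc_sub e" "rep e g = g \<otimes> a"
    using rep_in_coset unfolding l_coset_def by blast
  have "inv (rep e g) \<otimes> g = inv a"
    using a g assoc_sub_closed[OF a(1)] by (simp add: inv_mult_group m_assoc)
  then show ?thesis using a subgroup.m_inv_closed[OF assoc_sub] by simp
qed

lemma mult_in_assoc_sub_iff:
  "g \<in> carrier G \<Longrightarrow> a \<in> assoc_sub e \<Longrightarrow> g \<otimes> a \<in> assoc_sub e \<longleftrightarrow> g \<in> assoc_sub e"
  "g \<in> carrier G \<Longrightarrow> a \<in> assoc_sub e \<Longrightarrow> a \<otimes> g \<in> assoc_sub e \<longleftrightarrow> g \<in> assoc_sub e"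
proof -
  assume g: "g \<in> carrier G" and a: "a \<in> assoc_sub e"
  have ia: "inv a \<in> assoc_sub e" using a subgroup.m_inv_closed[OF assoc_sub] by blast
  have "g \<otimes> a \<otimes> inv a = g" "inv a \<otimes> (a \<otimes> g) = g"
    using g assoc_sub_closed[OF a] by (simp_all add: m_assoc inv_mult_cancel_left)
  then show "g \<otimes> a \<in> assoc_sub e \<longleftrightarrow> g \<in> assoc_sub e" "a \<otimes> g \<in> assoc_sub e \<longleftrightarrow> g \<in> assoc_sub e"
    using a ia subgroup.m_closed[OF assoc_sub] by metis+
qed

lemma rep_mult:
  assumes "g \<in> carrier G" "a \<in> assoc_sub e"
  shows "rep e (g \<otimes> a) = rep e g"
proof -
  have "g \<otimes> a \<in> g <# assoc_sub e" using assms by (auto simp: l_coset_def)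
  then have "(g \<otimes> a) <# assoc_sub e = g <# assoc_sub e"
    using l_repr_independence[OF _ assms(1) assoc_sub] by simp
  then show ?thesis using mult_in_assoc_sub_iff(1)[OF assms] by (simp add: rep_def)
qed

lemma rep_one_iff: "g \<in> carrier G \<Longrightarrow> rep e g = \<one> \<longleftrightarrow> g \<in> assoc_sub e"
  using rep_rest[of g e] by (auto simp: rep_def)

lemma rep_mult_rest: "g \<in> carrier G \<Longrightarrow> rep e g \<otimes> (inv (rep e g) \<otimes> g) = g"
  using rep_closed by (simp add: mult_inv_cancel_left)

lemma rep_rep: "g \<in> carrier G \<Longrightarrow> rep e (rep e g) = rep e g"
  using rep_mult[OF rep_closed rep_rest] rep_mult_rest by metis

text \<open>A normal form \<open>r\<^sub>1 t\<^sup>\<plusminus> r\<^sub>2 t\<^sup>\<plusminus> \<dots> g\<close> is acted on from the left: an element of \<open>G\<close> changes each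
  representative and hands the remaining element of the associated subgroup through the stable
  letter to the next syllable. The last clause of \<open>reduced\<close> excludes a cancelling pair
  \<open>t\<^sup>\<plusminus> \<one> t\<^sup>\<mp>\<close>.\<close>

primrec reduced :: "'a normal_form \<Rightarrow> bool" where
  "reduced (Tail g) \<longleftrightarrow> g \<in> carrier G"
| "reduced (Syllable r e n) \<longleftrightarrow>
     r \<in> carrier G \<and> rep e r = r \<and> reduced n \<and> (\<forall>m. n \<noteq> Syllable \<one> (\<not> e) m)"

primrec base_act :: "'a \<Rightarrow> 'a normal_form \<Rightarrow> 'a normal_form" where
  "base_act h (Tail g) = Tail (h \<otimes> g)"
| "base_act h (Syllable r e n) =
     Syllable (rep e (h \<otimes> r)) e (base_act (assoc_iso e (inv (rep e (h \<otimes> r)) \<otimes> (h \<otimes> r))) n)"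

definition stable_act :: "bool \<Rightarrow> 'a normal_form \<Rightarrow> 'a normal_form" where
  "stable_act e n = (case n of Tail g \<Rightarrow> Syllable \<one> e n
     | Syllable r e' m \<Rightarrow> if r = \<one> \<and> e' = (\<not> e) then m else Syllable \<one> e n)"

lemma stable_act_pop: "stable_act e (Syllable \<one> (\<not> e) m) = m"
  by (simp add: stable_act_def)

lemma stable_act_push: "(\<And>m. n \<noteq> Syllable \<one> (\<not> e) m) \<Longrightarrow> stable_act e n = Syllable \<one> e n"
  by (auto simp: stable_act_def split: normal_form.split)

text \<open>An element of the associated subgroup that arrives from the left neither creates nor destroys
  a cancellation with the next stable letter.\<close>

lemma base_act_assoc_head:
  assumes "reduced n" "a \<in> assoc_sub e"
  shows "(\<exists>m. base_act a n = Syllable \<one> e m) \<longleftrightarrow> (\<exists>m. n = Syllable \<one> e m)"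
proof (cases n)
  case (Syllable r e' m)
  then have r: "r \<in> carrier G" "rep e' r = r" using assms by auto
  have a: "a \<in> carrier G" using assms(2) by (rule assoc_sub_closed)
  have "e' = e \<Longrightarrow> rep e' (a \<otimes> r) = \<one> \<longleftrightarrow> r = \<one>"
    using mult_in_assoc_sub_iff(2)[OF r(1) assms(2)] rep_one_iff[of "a \<otimes> r" e] rep_one_iff[OF r(1), of e] r a
    by auto
  then show ?thesis using Syllable by auto
qed auto

lemma reduced_base_act: "reduced n \<Longrightarrow> h \<in> carrier G \<Longrightarrow> reduced (base_act h n)"
proof (induction n arbitrary: h)
  case (Syllable r e n)
  let ?a = "assoc_iso e (inv (rep e (h \<otimes> r)) \<otimes> (h \<otimes> r))"
  have hr: "h \<otimes> r \<in> carrier G" and n: "reduced n" using Syllable.prems by auto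
  have a: "?a \<in> assoc_sub (\<not> e)" by (rule assoc_iso_closed[OF rep_rest[OF hr]])
  have "reduced (base_act ?a n)"
    using Syllable.IH[OF n assoc_sub_closed[OF a]] .
  moreover have "base_act ?a n \<noteq> Syllable \<one> (\<not> e) m" for m
    using base_act_assoc_head[OF n a] Syllable.prems by auto
  ultimately show ?case using hr rep_closed rep_rep by simp
qed simp

lemma base_act_one: "reduced n \<Longrightarrow> base_act \<one> n = n"
  by (induction n) (simp_all add: assoc_iso_one)

lemma base_act_mult:
  "reduced n \<Longrightarrow> h \<in> carrier G \<Longrightarrow> k \<in> carrier G \<Longrightarrow>
    base_act (h \<otimes> k) n = base_act h (base_act k n)"
proof (induction n arbitrary: h k)
  case (Tail g)
  then show ?case by (simp add: m_assoc)
next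
  case (Syllable r e n)
  define s where "s = rep e (k \<otimes> r)"
  define a where "a = inv s \<otimes> (k \<otimes> r)"
  define q where "q = rep e (h \<otimes> s)"
  define b where "b = inv q \<otimes> (h \<otimes> s)"
  have c: "r \<in> carrier G" "reduced n" "h \<in> carrier G" "k \<in> carrier G"
    using Syllable.prems by auto
  have s: "s \<in> carrier G" and a: "a \<in> assoc_sub e" and sa: "s \<otimes> a = k \<otimes> r"
    using c rep_closed rep_rest rep_mult_rest by (simp_all add: s_def a_def)
  have q: "q \<in> carrier G" and b: "b \<in> assoc_sub e" and qb: "q \<otimes> b = h \<otimes> s"
    using c s rep_closed rep_rest rep_mult_rest by (simp_all add: q_def b_def)
  have aG: "a \<in> carrier G" and bG: "b \<in> carrier G" using a b assoc_sub_closed by auto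
  have hkr: "h \<otimes> k \<otimes> r = h \<otimes> s \<otimes> a"
    using c s aG sa by (simp add: m_assoc)
  have rp: "rep e (h \<otimes> k \<otimes> r) = q"
    unfolding hkr q_def using rep_mult[OF _ a] c s by simp
  have rest: "inv q \<otimes> (h \<otimes> k \<otimes> r) = b \<otimes> a"
    unfolding hkr b_def using c s q aG by (simp add: m_assoc)
  have "base_act (assoc_iso e (b \<otimes> a)) n = base_act (assoc_iso e b) (base_act (assoc_iso e a) n)"
    using Syllable.IH[OF c(2) assoc_iso_carrier[OF b] assoc_iso_carrier[OF a]] assoc_iso_mult[OF b a] by simp
  then show ?case
    by (simp add: rp rest flip: s_def a_def q_def b_def)
qed

lemma reduced_stable_act: "reduced n \<Longrightarrow> reduced (stable_act e n)"
proof (cases "\<exists>m. n = Syllable \<one> (\<not> e) m")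
  case False
  moreover assume "reduced n"
  moreover have "rep e \<one> = \<one>" using subgroup.one_closed[OF assoc_sub] by (simp add: rep_def)
  ultimately show ?thesis by (simp add: stable_act_push)
qed (auto simp: stable_act_pop)

lemma stable_act_cancel: "reduced n \<Longrightarrow> stable_act (\<not> e) (stable_act e n) = n"
proof (cases "\<exists>m. n = Syllable \<one> (\<not> e) m")
  case True
  then obtain m where m: "n = Syllable \<one> (\<not> e) m" by blast
  moreover assume "reduced n"
  ultimately have "m \<noteq> Syllable \<one> (\<not> \<not> e) k" for k by simp
  then show ?thesis using m stable_act_push[of m "\<not> e"] by (simp add: stable_act_pop)
next
  case False
  then show ?thesis using stable_act_pop[of "\<not> e" n] by (simp add: stable_act_push)
qed

lemma stable_act_conj:
  assumes n: "reduced n" and a: "a \<in> assoc_sub e"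
  shows "stable_act (\<not> e) (base_act a (stable_act e n)) = base_act (assoc_iso e a) n"
proof -
  have push: "base_act c (Syllable \<one> f m) = Syllable \<one> f (base_act (assoc_iso f c) m)"
    if "c \<in> assoc_sub f" for c f m
    using that assoc_sub_closed[OF that] by (simp add: rep_def)
  show ?thesis
  proof (cases "\<exists>m. n = Syllable \<one> (\<not> e) m")
    case True
    then obtain m where m: "n = Syllable \<one> (\<not> e) m" by blast
    then have "reduced m" "\<And>k. m \<noteq> Syllable \<one> e k" using n by auto
    then have "stable_act (\<not> e) (base_act a m) = Syllable \<one> (\<not> e) (base_act a m)"
      using base_act_assoc_head[OF _ a, of m] by (intro stable_act_push) auto
    then show ?thesis
      by (simp only: m stable_act_pop push[OF assoc_iso_closed[OF a]] assoc_iso_inverse[OF a])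
  next
    case False
    then have "stable_act e n = Syllable \<one> e n"
      by (intro stable_act_push) blast
    then show ?thesis
      using stable_act_pop[of "\<not> e"] by (simp only: push[OF a] not_not)
  qed
qed

primrec letter_act :: "'a hnn_letter \<Rightarrow> 'a normal_form \<Rightarrow> 'a normal_form" where
  "letter_act (Base g) = base_act g"
| "letter_act Stable = stable_act True"
| "letter_act StableInv = stable_act False"

abbreviation word_act :: "'a hnn_letter list \<Rightarrow> 'a normal_form \<Rightarrow> 'a normal_form" where
  "word_act \<equiv> foldr letter_act"

lemma reduced_word_act: "w \<in> hnn_words G \<Longrightarrow> reduced n \<Longrightarrow> reduced (word_act w n)"
proof (induction w)
  case (Cons x w)
  then show ?case by (cases x) (auto simp: reduced_base_act reduced_stable_act)
qed simp

text \<open>All defining relations hold in the action, which makes the normal form of a group element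
  well defined.\<close>

lemma word_act_rel: "(u, v) \<in> R \<Longrightarrow> reduced n \<Longrightarrow> word_act u n = word_act v n"
proof (induction arbitrary: n rule: hnn_rel.induct)
  case (append u v u' v')
  then show ?case using rel_words reduced_word_act by (metis foldr_append comp_apply)
next
  case (stable_conj a)
  then show ?case
    using stable_act_conj[of n a True] by (simp add: assoc_sub_def assoc_iso_def)
next
  case stable_right
  then show ?case using stable_act_cancel[of n False] by simp
next
  case stable_left
  then show ?case using stable_act_cancel[of n True] by simp
qed (simp_all add: base_act_one base_act_mult)

definition nf :: "'a hnn_letter list set \<Rightarrow> 'a normal_form" where
  "nf U = word_act (SOME w. w \<in> U) (Tail \<one>)"

lemma nf_class: "w \<in> hnn_words G \<Longrightarrow> nf (R `` {w}) = word_act w (Tail \<one>)"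
proof -
  assume w: "w \<in> hnn_words G"
  then have "w \<in> R `` {w}" by (auto intro: hnn_rel.refl)
  then have "(SOME v. v \<in> R `` {w}) \<in> R `` {w}" by (rule someI)
  then show ?thesis unfolding nf_def using word_act_rel[of w _ "Tail \<one>"] by simp
qed

abbreviation \<iota> :: "'a \<Rightarrow> 'a hnn_letter list set" where
  "\<iota> \<equiv> hnn_base G A \<phi>"

definition stable_pm :: "bool \<Rightarrow> 'a hnn_letter list set" where
  "stable_pm e = R `` {[if e then Stable else StableInv]}"

lemma stable_pm_True: "stable_pm True = hnn_stable G A \<phi>"
  by (simp add: stable_pm_def hnn_stable_def)

lemma stable_pm_closed: "stable_pm e \<in> carrier H"
  unfolding stable_pm_def by (intro class_in_carrier) auto

lemma \<iota>_closed: "g \<in> carrier G \<Longrightarrow> \<iota> g \<in> carrier H"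
  using hnn_base_hom by (rule hom_in_carrier)

lemma \<iota>_mult: "g \<in> carrier G \<Longrightarrow> h \<in> carrier G \<Longrightarrow> \<iota> (g \<otimes> h) = \<iota> g \<otimes>\<^bsub>H\<^esub> \<iota> h"
  using hnn_base_hom by (rule hom_mult)

lemma inv_stable_pm: "inv\<^bsub>H\<^esub> stable_pm e = stable_pm (\<not> e)"
  using inv_hnn_stable ext.inv_inv[OF hnn_stable_closed]
  by (cases e) (auto simp: stable_pm_def hnn_stable_def)

lemma stable_pm_cancel: "stable_pm (\<not> e) \<otimes>\<^bsub>H\<^esub> stable_pm e = \<one>\<^bsub>H\<^esub>"
  using ext.l_inv[OF stable_pm_closed, of e] by (simp add: inv_stable_pm)

lemma \<iota>_stable_pm:
  assumes a: "a \<in> assoc_sub e"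
  shows "\<iota> a \<otimes>\<^bsub>H\<^esub> stable_pm e = stable_pm e \<otimes>\<^bsub>H\<^esub> \<iota> (assoc_iso e a)"
proof (cases e)
  case True
  let ?t = "hnn_stable G A \<phi>"
  have aA: "a \<in> A" using a True by (simp add: assoc_sub_def)
  have c: "\<iota> a \<in> carrier H" using \<iota>_closed assoc_sub_closed[OF a] by blast
  have "?t \<otimes>\<^bsub>H\<^esub> \<iota> (\<phi> a) = ?t \<otimes>\<^bsub>H\<^esub> (inv\<^bsub>H\<^esub> ?t \<otimes>\<^bsub>H\<^esub> \<iota> a \<otimes>\<^bsub>H\<^esub> ?t)"
    using hnn_stable_conj[OF aA] by simp
  also have "\<dots> = \<iota> a \<otimes>\<^bsub>H\<^esub> ?t"
    using c hnn_stable_closed by (simp add: ext.m_assoc ext.mult_inv_cancel_left)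
  finally show ?thesis using True by (simp add: stable_pm_True assoc_iso_def)
next
  case False
  let ?t = "hnn_stable G A \<phi>" and ?b = "assoc_iso e a"
  have bA: "?b \<in> A" using assoc_iso_closed[OF a] False by (simp add: assoc_sub_def)
  have ba: "\<phi> ?b = a" using assoc_iso_inverse[OF a] False by (simp add: assoc_iso_def)
  have c: "\<iota> ?b \<in> carrier H" using \<iota>_closed assoc_iso_carrier[OF a] by blast
  have "\<iota> a \<otimes>\<^bsub>H\<^esub> inv\<^bsub>H\<^esub> ?t = inv\<^bsub>H\<^esub> ?t \<otimes>\<^bsub>H\<^esub> \<iota> ?b \<otimes>\<^bsub>H\<^esub> ?t \<otimes>\<^bsub>H\<^esub> inv\<^bsub>H\<^esub> ?t"
    using hnn_stable_conj[OF bA] ba by simp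
  also have "\<dots> = inv\<^bsub>H\<^esub> ?t \<otimes>\<^bsub>H\<^esub> \<iota> ?b"
    using c hnn_stable_closed by (simp add: ext.m_assoc)
  finally show ?thesis using False inv_stable_pm[of True] by (simp add: stable_pm_True)
qed

lemma nf_one: "nf \<one>\<^bsub>H\<^esub> = Tail \<one>"
  using nf_class[of "[]"] by (simp add: one_class)

lemma nf_reduced: "U \<in> carrier H \<Longrightarrow> reduced (nf U)"
  by (elim carrierE) (simp add: nf_class reduced_word_act)

lemma nf_base_mult: "g \<in> carrier G \<Longrightarrow> U \<in> carrier H \<Longrightarrow> nf (\<iota> g \<otimes>\<^bsub>H\<^esub> U) = base_act g (nf U)"
  by (elim carrierE) (simp add: hnn_base_def class_mult nf_class)

lemma nf_stable_mult: "U \<in> carrier H \<Longrightarrow> nf (stable_pm e \<otimes>\<^bsub>H\<^esub> U) = stable_act e (nf U)"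
  by (elim carrierE) (simp add: stable_pm_def class_mult nf_class)

lemma nf_base: "g \<in> carrier G \<Longrightarrow> nf (\<iota> g) = Tail g"
  using nf_base_mult[of g "\<one>\<^bsub>H\<^esub>"] \<iota>_closed by (simp add: nf_one)

primrec nf_value :: "'a normal_form \<Rightarrow> 'a hnn_letter list set" where
  "nf_value (Tail g) = \<iota> g"
| "nf_value (Syllable r e n) = \<iota> r \<otimes>\<^bsub>H\<^esub> (stable_pm e \<otimes>\<^bsub>H\<^esub> nf_value n)"

lemma nf_value_closed: "reduced n \<Longrightarrow> nf_value n \<in> carrier H"
  by (induction n) (simp_all add: \<iota>_closed stable_pm_closed)

lemma nf_value_base_act:
  "reduced n \<Longrightarrow> h \<in> carrier G \<Longrightarrow> nf_value (base_act h n) = \<iota> h \<otimes>\<^bsub>H\<^esub> nf_value n"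
proof (induction n arbitrary: h)
  case (Tail g)
  then show ?case by (simp add: \<iota>_mult)
next
  case (Syllable r e n)
  define s where "s = rep e (h \<otimes> r)"
  define a where "a = inv s \<otimes> (h \<otimes> r)"
  have c: "r \<in> carrier G" "reduced n" "h \<in> carrier G" using Syllable.prems by auto
  have s: "s \<in> carrier G" and a: "a \<in> assoc_sub e" and sa: "s \<otimes> a = h \<otimes> r"
    using c rep_closed rep_rest rep_mult_rest by (simp_all add: s_def a_def)
  note cl = \<iota>_closed[OF s] \<iota>_closed[OF assoc_sub_closed[OF a]] \<iota>_closed[OF assoc_iso_carrier[OF a]]
    nf_value_closed[OF c(2)] stable_pm_closed \<iota>_closed[OF c(1)] \<iota>_closed[OF c(3)]
  have "nf_value (base_act h (Syllable r e n)) =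
      \<iota> s \<otimes>\<^bsub>H\<^esub> (stable_pm e \<otimes>\<^bsub>H\<^esub> (\<iota> (assoc_iso e a) \<otimes>\<^bsub>H\<^esub> nf_value n))"
    using Syllable.IH[OF c(2) assoc_iso_carrier[OF a]] by (simp flip: s_def a_def)
  also have "\<dots> = \<iota> s \<otimes>\<^bsub>H\<^esub> (\<iota> a \<otimes>\<^bsub>H\<^esub> stable_pm e \<otimes>\<^bsub>H\<^esub> nf_value n)"
    unfolding \<iota>_stable_pm[OF a] using cl by (simp add: ext.m_assoc)
  also have "\<dots> = \<iota> (s \<otimes> a) \<otimes>\<^bsub>H\<^esub> (stable_pm e \<otimes>\<^bsub>H\<^esub> nf_value n)"
    using cl s assoc_sub_closed[OF a] by (simp add: ext.m_assoc \<iota>_mult)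
  also have "\<dots> = \<iota> h \<otimes>\<^bsub>H\<^esub> nf_value (Syllable r e n)"
    unfolding sa using cl c by (simp add: ext.m_assoc \<iota>_mult)
  finally show ?case .
qed

lemma nf_value_stable_act:
  assumes "reduced n"
  shows "nf_value (stable_act e n) = stable_pm e \<otimes>\<^bsub>H\<^esub> nf_value n"
proof -
  have one: "\<iota> \<one> = \<one>\<^bsub>H\<^esub>" using hom_one[OF hnn_base_hom is_group ext.is_group] .
  show ?thesis
  proof (cases "\<exists>m. n = Syllable \<one> (\<not> e) m")
    case True
    then obtain m where m: "n = Syllable \<one> (\<not> e) m" by blast
    then have mc: "nf_value m \<in> carrier H" using assms nf_value_closed by simp
    have "stable_pm e \<otimes>\<^bsub>H\<^esub> nf_value n = stable_pm e \<otimes>\<^bsub>H\<^esub> stable_pm (\<not> e) \<otimes>\<^bsub>H\<^esub> nf_value m"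
      using m one mc stable_pm_closed by (simp add: ext.m_assoc)
    then show ?thesis
      using m mc stable_pm_cancel[of "\<not> e"] by (simp add: stable_act_pop)
  next
    case False
    then show ?thesis
      using one assms nf_value_closed stable_pm_closed by (simp add: stable_act_push)
  qed
qed

text \<open>The normal form determines the element, since the action is left multiplication in
  disguise.\<close>

lemma nf_value_nf:
  assumes "U \<in> carrier H"
  shows "nf_value (nf U) = U"
proof -
  have "nf_value (word_act w (Tail \<one>)) = R `` {w}" if "w \<in> hnn_words G" for w
    using that
  proof (induction w)
    case Nil
    then show ?case using hom_one[OF hnn_base_hom is_group ext.is_group] by (simp add: one_class)
  next
    case (Cons x w)
    have x: "[x] \<in> hnn_words G" and w: "w \<in> hnn_words G" using Cons.prems by auto
    have red: "reduced (word_act w (Tail \<one>))" using reduced_word_act[OF w] by simp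
    have "nf_value (word_act (x # w) (Tail \<one>)) = R `` {[x]} \<otimes>\<^bsub>H\<^esub> R `` {w}"
      using x red Cons.IH[OF w]
      by (cases x) (auto simp: nf_value_base_act nf_value_stable_act hnn_base_def stable_pm_def)
    then show ?case using class_mult[OF x w] by simp
  qed
  then show ?thesis using assms by (elim carrierE) (simp add: nf_class)
qed

text \<open>The number of occurrences of the stable letter in the normal form is the distance between
  the vertices \<open>G\<close> and \<open>U G\<close> of the tree below.\<close>

definition stable_length :: "'a hnn_letter list set \<Rightarrow> nat" where
  "stable_length U = syllables (nf U)"

lemma syllables_base_act: "syllables (base_act h n) = syllables n"
  by (induction n arbitrary: h) simp_all

lemma syllables_stable_act:
  "syllables (stable_act e n) = Suc (syllables n) \<or> syllables n = Suc (syllables (stable_act e n))"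
  by (auto simp: stable_act_def split: normal_form.split)

lemma stable_length_base_left:
  "g \<in> carrier G \<Longrightarrow> U \<in> carrier H \<Longrightarrow> stable_length (\<iota> g \<otimes>\<^bsub>H\<^esub> U) = stable_length U"
  by (simp add: stable_length_def nf_base_mult syllables_base_act)

lemma stable_length_base_right:
  assumes "g \<in> carrier G" "U \<in> carrier H"
  shows "stable_length (U \<otimes>\<^bsub>H\<^esub> \<iota> g) = stable_length U"
proof -
  \<comment> \<open>Multiplication on the right reaches only the last entry of a normal form and commutes with the
    action from the left.\<close>
  define rmul where "rmul = rec_normal_form (\<lambda>k. Tail (k \<otimes> g)) (\<lambda>r e _ n. Syllable r e n)"
  have rmul: "rmul (Tail k) = Tail (k \<otimes> g)" "rmul (Syllable r e n) = Syllable r e (rmul n)" for k r e n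
    by (simp_all add: rmul_def)
  have b: "reduced n \<Longrightarrow> h \<in> carrier G \<Longrightarrow> base_act h (rmul n) = rmul (base_act h n)" for h n
  proof (induction n arbitrary: h)
    case (Syllable r e n)
    then show ?case using assoc_iso_carrier rep_rest by (simp add: rmul)
  qed (simp add: rmul assms m_assoc)
  have s: "stable_act e (rmul n) = rmul (stable_act e n)" for e n
    by (cases n) (simp_all add: rmul stable_act_def)
  have len: "syllables (rmul n) = syllables n" for n
    by (induction n) (simp_all add: rmul)
  have w: "word_act w (rmul (Tail \<one>)) = rmul (word_act w (Tail \<one>))" if "w \<in> hnn_words G" for w
    using that
  proof (induction w)
    case (Cons x w)
    then have "reduced (word_act w (Tail \<one>))" using reduced_word_act by simp
    then show ?case using Cons by (cases x) (auto simp: b s)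
  qed simp
  obtain u where u: "u \<in> hnn_words G" "U = R `` {u}" using assms(2) by (rule carrierE)
  have "nf (U \<otimes>\<^bsub>H\<^esub> \<iota> g) = word_act u (rmul (Tail \<one>))"
    using u assms by (simp add: hnn_base_def class_mult nf_class rmul)
  also have "\<dots> = rmul (nf U)" using w u by (simp add: nf_class)
  finally show ?thesis by (simp add: stable_length_def len)
qed

lemma stable_length_stable:
  "U \<in> carrier H \<Longrightarrow> stable_length (stable_pm e \<otimes>\<^bsub>H\<^esub> U) = Suc (stable_length U) \<or>
    stable_length U = Suc (stable_length (stable_pm e \<otimes>\<^bsub>H\<^esub> U))"
  using syllables_stable_act by (simp add: stable_length_def nf_stable_mult)

lemma stable_length_zero:
  assumes "U \<in> carrier H"
  shows "stable_length U = 0 \<longleftrightarrow> U \<in> \<iota> ` carrier G"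
proof
  assume "stable_length U = 0"
  then obtain g where g: "nf U = Tail g" by (cases "nf U") (auto simp: stable_length_def)
  then show "U \<in> \<iota> ` carrier G"
    using nf_value_nf[OF assms] nf_reduced[OF assms] by auto
qed (auto simp: stable_length_def nf_base)

text \<open>The length drops only when the stable letter cancels the first one of the normal form.\<close>

lemma stable_length_decreases:
  assumes U: "U \<in> carrier H" and less: "stable_length (stable_pm (\<not> e) \<otimes>\<^bsub>H\<^esub> U) < stable_length U"
  obtains m where "nf U = Syllable \<one> e m"
proof (rule ccontr)
  assume "\<not> thesis"
  then have "nf U \<noteq> Syllable \<one> (\<not> \<not> e) m" for m using that by auto
  then have "stable_act (\<not> e) (nf U) = Syllable \<one> (\<not> e) (nf U)" by (rule stable_act_push)
  then show False using less by (simp add: stable_length_def nf_stable_mult[OF U])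
qed

text \<open>The case of Britton's lemma needed for edge stabilizers: outside the associated subgroup the
  word has a normal form with two stable letters.\<close>

lemma stable_conj_in_base:
  assumes g: "g \<in> carrier G"
    and "stable_pm (\<not> e) \<otimes>\<^bsub>H\<^esub> \<iota> g \<otimes>\<^bsub>H\<^esub> stable_pm e \<in> \<iota> ` carrier G"
  shows "g \<in> assoc_sub e"
proof -
  let ?n = "Syllable (rep e g) e (base_act (assoc_iso e (inv (rep e g) \<otimes> g)) (Tail \<one>))"
  have c: "stable_pm e \<in> carrier H" "\<iota> g \<in> carrier H" using stable_pm_closed \<iota>_closed g by auto
  have "nf (stable_pm e) = Syllable \<one> e (Tail \<one>)"
    using nf_stable_mult[of "\<one>\<^bsub>H\<^esub>" e] stable_pm_closed by (simp add: nf_one stable_act_push)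
  then have "nf (stable_pm (\<not> e) \<otimes>\<^bsub>H\<^esub> (\<iota> g \<otimes>\<^bsub>H\<^esub> stable_pm e)) = stable_act (\<not> e) ?n"
    using c g by (simp add: nf_stable_mult nf_base_mult)
  moreover have "syllables (nf (stable_pm (\<not> e) \<otimes>\<^bsub>H\<^esub> (\<iota> g \<otimes>\<^bsub>H\<^esub> stable_pm e))) = 0"
    using assms(2) stable_length_zero c stable_pm_closed by (simp add: ext.m_assoc stable_length_def)
  ultimately have "rep e g = \<one>"
    by (auto simp: stable_act_def split: if_splits)
  then show ?thesis using rep_one_iff[OF g] by simp
qed

end

section \<open>The Bass-Serre tree of an HNN-extension\<close>

context hnn_iso
begin

text \<open>The vertices are the left cosets \<open>h G\<close>, and an edge leads from \<open>h G\<close> to \<open>h t G\<close>. The distance is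
  measured between representatives, which are chosen arbitrarily: the length ignores factors
  from \<open>G\<close> on either side.\<close>

definition base_sub :: "'a hnn_letter list set set" where
  "base_sub = \<iota> ` carrier G"

definition vertex :: "'a hnn_letter list set \<Rightarrow> 'a hnn_letter list set set" where
  "vertex h = h <#\<^bsub>H\<^esub> base_sub"

definition tree_edges :: "('a hnn_letter list set set \<times> 'a hnn_letter list set set) set" where
  "tree_edges = (\<lambda>h. (vertex h, vertex (h \<otimes>\<^bsub>H\<^esub> stable_pm True))) ` carrier H"

definition tree_dist :: "'a hnn_letter list set set \<Rightarrow> 'a hnn_letter list set set \<Rightarrow> nat" where
  "tree_dist P Q = stable_length (inv\<^bsub>H\<^esub> (SOME h. h \<in> carrier H \<and> P = vertex h) \<otimes>\<^bsub>H\<^esub>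
     (SOME k. k \<in> carrier H \<and> Q = vertex k))"

lemma base_sub: "subgroup base_sub H"
proof -
  interpret \<iota>: group_hom G H \<iota>
    using hnn_base_hom is_group ext.is_group by (simp add: group_hom_def group_hom_axioms_def)
  show ?thesis unfolding base_sub_def by (rule \<iota>.img_is_subgroup)
qed

lemma inv_\<iota>: "g \<in> carrier G \<Longrightarrow> inv\<^bsub>H\<^esub> \<iota> g = \<iota> (inv g)"
proof -
  interpret \<iota>: group_hom G H \<iota>
    using hnn_base_hom is_group ext.is_group by (simp add: group_hom_def group_hom_axioms_def)
  show "g \<in> carrier G \<Longrightarrow> inv\<^bsub>H\<^esub> \<iota> g = \<iota> (inv g)" by simp
qed

lemma inj_\<iota>: "inj_on \<iota> (carrier G)"
  by (rule inj_onI) (metis nf_base normal_form.inject(1))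

lemma vertex_eq_iff:
  assumes "h \<in> carrier H" "k \<in> carrier H"
  shows "vertex h = vertex k \<longleftrightarrow> (\<exists>g\<in>carrier G. k = h \<otimes>\<^bsub>H\<^esub> \<iota> g)"
proof
  assume "vertex h = vertex k"
  then have "k \<in> h <#\<^bsub>H\<^esub> base_sub"
    using ext.lcos_self[OF assms(2) base_sub] by (simp add: vertex_def)
  then show "\<exists>g\<in>carrier G. k = h \<otimes>\<^bsub>H\<^esub> \<iota> g"
    unfolding l_coset_def base_sub_def by blast
next
  assume "\<exists>g\<in>carrier G. k = h \<otimes>\<^bsub>H\<^esub> \<iota> g"
  then have "k \<in> h <#\<^bsub>H\<^esub> base_sub" unfolding l_coset_def base_sub_def by blast
  then show "vertex h = vertex k"
    unfolding vertex_def by (rule ext.l_repr_independence[OF _ assms(1) base_sub])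
qed

lemma vertex_eq_iff':
  assumes "h \<in> carrier H" "k \<in> carrier H"
  shows "vertex h = vertex k \<longleftrightarrow> inv\<^bsub>H\<^esub> h \<otimes>\<^bsub>H\<^esub> k \<in> \<iota> ` carrier G"
proof -
  have "k = h \<otimes>\<^bsub>H\<^esub> \<iota> g \<longleftrightarrow> inv\<^bsub>H\<^esub> h \<otimes>\<^bsub>H\<^esub> k = \<iota> g" if "g \<in> carrier G" for g
    using that assms \<iota>_closed ext.inv_solve_left[of "\<iota> g" h k] by (metis ext.inv_mult_cancel_left ext.mult_inv_cancel_left)
  then show ?thesis unfolding vertex_eq_iff[OF assms] by auto
qed

lemma tree_dist_vertex:
  assumes h: "h \<in> carrier H" and k: "k \<in> carrier H"
  shows "tree_dist (vertex h) (vertex k) = stable_length (inv\<^bsub>H\<^esub> h \<otimes>\<^bsub>H\<^esub> k)"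
proof -
  define h' where "h' = (SOME x. x \<in> carrier H \<and> vertex h = vertex x)"
  define k' where "k' = (SOME x. x \<in> carrier H \<and> vertex k = vertex x)"
  have "h' \<in> carrier H \<and> vertex h = vertex h'"
    unfolding h'_def by (rule someI[of _ h]) (use h in simp)
  then obtain a where a: "a \<in> carrier G" "h' = h \<otimes>\<^bsub>H\<^esub> \<iota> a"
    using vertex_eq_iff h by blast
  have "k' \<in> carrier H \<and> vertex k = vertex k'"
    unfolding k'_def by (rule someI[of _ k]) (use k in simp)
  then obtain b where b: "b \<in> carrier G" "k' = k \<otimes>\<^bsub>H\<^esub> \<iota> b"
    using vertex_eq_iff k by blast
  have "inv\<^bsub>H\<^esub> h' \<otimes>\<^bsub>H\<^esub> k' = \<iota> (inv a) \<otimes>\<^bsub>H\<^esub> (inv\<^bsub>H\<^esub> h \<otimes>\<^bsub>H\<^esub> k \<otimes>\<^bsub>H\<^esub> \<iota> b)"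
    using a b h k \<iota>_closed by (simp add: ext.inv_mult_group ext.m_assoc inv_\<iota>)
  then have "stable_length (inv\<^bsub>H\<^esub> h' \<otimes>\<^bsub>H\<^esub> k') = stable_length (inv\<^bsub>H\<^esub> h \<otimes>\<^bsub>H\<^esub> k)"
    using a b h k \<iota>_closed by (simp add: stable_length_base_left stable_length_base_right)
  then show ?thesis by (simp add: tree_dist_def h'_def k'_def)
qed

lemma tree_adj_iff:
  "(u, v) \<in> tree_edges \<union> tree_edges\<inverse> \<longleftrightarrow>
    (\<exists>h\<in>carrier H. \<exists>e. u = vertex h \<and> v = vertex (h \<otimes>\<^bsub>H\<^esub> stable_pm e))"
proof
  assume "(u, v) \<in> tree_edges \<union> tree_edges\<inverse>"
  then consider h where "h \<in> carrier H" "u = vertex h" "v = vertex (h \<otimes>\<^bsub>H\<^esub> stable_pm True)"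
    | h where "h \<in> carrier H" "v = vertex h" "u = vertex (h \<otimes>\<^bsub>H\<^esub> stable_pm True)"
    unfolding tree_edges_def by auto
  then show "\<exists>h\<in>carrier H. \<exists>e. u = vertex h \<and> v = vertex (h \<otimes>\<^bsub>H\<^esub> stable_pm e)"
  proof cases
    case 1
    then show ?thesis by blast
  next
    case 2
    have "h \<otimes>\<^bsub>H\<^esub> stable_pm True \<otimes>\<^bsub>H\<^esub> stable_pm False = h"
      using 2(1) stable_pm_closed stable_pm_cancel[of False] by (simp add: ext.m_assoc)
    then show ?thesis using 2 stable_pm_closed by (metis ext.m_closed)
  qed
next
  assume "\<exists>h\<in>carrier H. \<exists>e. u = vertex h \<and> v = vertex (h \<otimes>\<^bsub>H\<^esub> stable_pm e)"
  then obtain h e where h: "h \<in> carrier H" "u = vertex h" "v = vertex (h \<otimes>\<^bsub>H\<^esub> stable_pm e)"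
    by blast
  show "(u, v) \<in> tree_edges \<union> tree_edges\<inverse>"
  proof (cases e)
    case True
    then show ?thesis using h by (auto simp: tree_edges_def)
  next
    case False
    let ?k = "h \<otimes>\<^bsub>H\<^esub> stable_pm False"
    have "?k \<otimes>\<^bsub>H\<^esub> stable_pm True = h"
      using h(1) stable_pm_closed stable_pm_cancel[of True] by (simp add: ext.m_assoc)
    then have "(v, u) \<in> tree_edges"
      unfolding tree_edges_def using h False stable_pm_closed
      by (intro image_eqI[of _ _ ?k]) auto
    then show ?thesis by simp
  qed
qed

lemma inv_mult_stable_pm:
  assumes "h \<in> carrier H" "k \<in> carrier H"
  shows "inv\<^bsub>H\<^esub> (h \<otimes>\<^bsub>H\<^esub> stable_pm e) \<otimes>\<^bsub>H\<^esub> k = stable_pm (\<not> e) \<otimes>\<^bsub>H\<^esub> (inv\<^bsub>H\<^esub> h \<otimes>\<^bsub>H\<^esub> k)"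
  using assms stable_pm_closed by (simp add: ext.inv_mult_group inv_stable_pm ext.m_assoc)

text \<open>The edges of sign \<open>e\<close> at \<open>h G\<close> correspond to the cosets of the associated subgroup.\<close>

lemma vertex_mult_stable_pm_cong:
  assumes "h \<in> carrier H" "g \<in> assoc_sub e"
  shows "vertex (h \<otimes>\<^bsub>H\<^esub> \<iota> g \<otimes>\<^bsub>H\<^esub> stable_pm e) = vertex (h \<otimes>\<^bsub>H\<^esub> stable_pm e)"
proof -
  have c: "\<iota> g \<in> carrier H" "\<iota> (assoc_iso e g) \<in> carrier H" "stable_pm e \<in> carrier H"
    using assms \<iota>_closed assoc_sub_closed assoc_iso_carrier stable_pm_closed by auto
  have "h \<otimes>\<^bsub>H\<^esub> \<iota> g \<otimes>\<^bsub>H\<^esub> stable_pm e = h \<otimes>\<^bsub>H\<^esub> stable_pm e \<otimes>\<^bsub>H\<^esub> \<iota> (assoc_iso e g)"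
    using assms(1) c \<iota>_stable_pm[OF assms(2)] by (simp add: ext.m_assoc)
  then show ?thesis
    using vertex_eq_iff[of "h \<otimes>\<^bsub>H\<^esub> stable_pm e" "h \<otimes>\<^bsub>H\<^esub> \<iota> g \<otimes>\<^bsub>H\<^esub> stable_pm e"] assms c
      assoc_iso_carrier by (metis ext.m_closed)
qed

text \<open>The first syllable of the normal form of \<open>h\<^sup>-\<^sup>1 k\<close> names the unique edge at \<open>h G\<close>
  in the direction of \<open>k G\<close>.\<close>

lemma oriented_tree_hnn: "oriented_tree (vertex ` carrier H) tree_edges tree_dist"
proof
  fix u v
  assume "(u, v) \<in> tree_edges"
  then show "u \<in> vertex ` carrier H \<and> v \<in> vertex ` carrier H"
    using stable_pm_closed by (auto simp: tree_edges_def)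
next
  fix u v
  assume "(u, v) \<in> tree_edges"
  then obtain h where h: "h \<in> carrier H" "u = vertex h" "v = vertex (h \<otimes>\<^bsub>H\<^esub> stable_pm True)"
    by (auto simp: tree_edges_def)
  show "(v, u) \<notin> tree_edges"
  proof
    let ?t = "stable_pm True"
    have t: "?t \<in> carrier H" by (rule stable_pm_closed)
    assume "(v, u) \<in> tree_edges"
    then obtain k where k: "k \<in> carrier H" "v = vertex k" "u = vertex (k \<otimes>\<^bsub>H\<^esub> ?t)"
      by (auto simp: tree_edges_def)
    then obtain g where g: "g \<in> carrier G" "k = h \<otimes>\<^bsub>H\<^esub> ?t \<otimes>\<^bsub>H\<^esub> \<iota> g"
      using h vertex_eq_iff t by (metis ext.m_closed)
    have g': "\<iota> g \<in> carrier H" using g(1) by (rule \<iota>_closed)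
    have "inv\<^bsub>H\<^esub> h \<otimes>\<^bsub>H\<^esub> (k \<otimes>\<^bsub>H\<^esub> ?t) = ?t \<otimes>\<^bsub>H\<^esub> (\<iota> g \<otimes>\<^bsub>H\<^esub> ?t)"
      using g g' h(1) t by (simp add: ext.m_assoc ext.inv_mult_cancel_left)
    then have "?t \<otimes>\<^bsub>H\<^esub> (\<iota> g \<otimes>\<^bsub>H\<^esub> ?t) \<in> \<iota> ` carrier G"
      using vertex_eq_iff'[of h "k \<otimes>\<^bsub>H\<^esub> ?t"] h k t by simp
    then have "stable_length (?t \<otimes>\<^bsub>H\<^esub> (\<iota> g \<otimes>\<^bsub>H\<^esub> ?t)) = 0"
      using stable_length_zero g' t by simp
    moreover have "nf ?t = Syllable \<one> True (Tail \<one>)"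
      using nf_stable_mult[of "\<one>\<^bsub>H\<^esub>" True] t by (simp add: nf_one stable_act_push)
    ultimately show False
      using t g(1) g' by (simp add: stable_length_def nf_stable_mult nf_base_mult stable_act_push)
  qed
next
  fix u w
  assume "u \<in> vertex ` carrier H" "w \<in> vertex ` carrier H"
  then obtain h k where "h \<in> carrier H" "k \<in> carrier H" "u = vertex h" "w = vertex k" by blast
  then show "tree_dist u w = 0 \<longleftrightarrow> u = w"
    by (simp add: tree_dist_vertex vertex_eq_iff' stable_length_zero)
next
  fix u p w
  assume "(u, p) \<in> tree_edges \<union> tree_edges\<inverse>" "w \<in> vertex ` carrier H"
  then obtain h e k where h: "h \<in> carrier H" "u = vertex h" "p = vertex (h \<otimes>\<^bsub>H\<^esub> stable_pm e)"
    and k: "k \<in> carrier H" "w = vertex k"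
    unfolding tree_adj_iff by blast
  then show "tree_dist p w = Suc (tree_dist u w) \<or> tree_dist u w = Suc (tree_dist p w)"
    using stable_length_stable[of "inv\<^bsub>H\<^esub> h \<otimes>\<^bsub>H\<^esub> k" "\<not> e"] stable_pm_closed
    by (simp add: tree_dist_vertex inv_mult_stable_pm)
next
  fix u w
  assume "u \<in> vertex ` carrier H" "w \<in> vertex ` carrier H" "u \<noteq> w"
  then obtain h k where h: "h \<in> carrier H" "k \<in> carrier H" "u = vertex h" "w = vertex k" by blast
  let ?U = "inv\<^bsub>H\<^esub> h \<otimes>\<^bsub>H\<^esub> k"
  have U: "?U \<in> carrier H" using h by simp
  have "stable_length ?U \<noteq> 0"
    using \<open>u \<noteq> w\<close> h vertex_eq_iff' stable_length_zero[OF U] by simp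
  then obtain r e n where n: "nf ?U = Syllable r e n"
    by (cases "nf ?U") (auto simp: stable_length_def)
  then have r: "r \<in> carrier G" using nf_reduced[OF U] by simp
  have r': "\<iota> r \<in> carrier H" "\<iota> (inv r) \<in> carrier H" using r \<iota>_closed by auto
  let ?p = "h \<otimes>\<^bsub>H\<^esub> \<iota> r"
  have p: "?p \<in> carrier H" using h r' by simp
  have "nf (\<iota> (inv r) \<otimes>\<^bsub>H\<^esub> ?U) = Syllable \<one> e (base_act \<one> n)"
    using n r U subgroup.one_closed[OF assoc_sub, of e]
    by (simp add: nf_base_mult rep_def assoc_iso_one)
  then have "nf (stable_pm (\<not> e) \<otimes>\<^bsub>H\<^esub> (\<iota> (inv r) \<otimes>\<^bsub>H\<^esub> ?U)) = base_act \<one> n"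
    using stable_act_pop[of "\<not> e"] U r' by (simp add: nf_stable_mult)
  moreover have "inv\<^bsub>H\<^esub> ?p \<otimes>\<^bsub>H\<^esub> k = \<iota> (inv r) \<otimes>\<^bsub>H\<^esub> ?U"
    using h r r' by (simp add: ext.inv_mult_group inv_\<iota> ext.m_assoc)
  ultimately have "stable_length (inv\<^bsub>H\<^esub> (?p \<otimes>\<^bsub>H\<^esub> stable_pm e) \<otimes>\<^bsub>H\<^esub> k) < stable_length ?U"
    using inv_mult_stable_pm[OF p h(2)] n by (simp add: stable_length_def syllables_base_act)
  then have "tree_dist (vertex (?p \<otimes>\<^bsub>H\<^esub> stable_pm e)) w < tree_dist u w"
    using h p stable_pm_closed by (simp add: tree_dist_vertex)
  moreover have "u = vertex ?p" using vertex_eq_iff[OF h(1) p] r h(3) by blast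
  ultimately show "\<exists>p. (u, p) \<in> tree_edges \<union> tree_edges\<inverse> \<and> tree_dist p w < tree_dist u w"
    unfolding tree_adj_iff using p by blast
next
  fix w u p q
  assume "w \<in> vertex ` carrier H" "(u, p) \<in> tree_edges \<union> tree_edges\<inverse>" "(u, q) \<in> tree_edges \<union> tree_edges\<inverse>"
    and less: "tree_dist p w < tree_dist u w" "tree_dist q w < tree_dist u w"
  then obtain h e h' e' k where h: "h \<in> carrier H" "u = vertex h" "p = vertex (h \<otimes>\<^bsub>H\<^esub> stable_pm e)"
    and h': "h' \<in> carrier H" "u = vertex h'" "q = vertex (h' \<otimes>\<^bsub>H\<^esub> stable_pm e')"
    and k: "k \<in> carrier H" "w = vertex k"
    unfolding tree_adj_iff by blast
  let ?U = "inv\<^bsub>H\<^esub> h \<otimes>\<^bsub>H\<^esub> k" and ?U' = "inv\<^bsub>H\<^esub> h' \<otimes>\<^bsub>H\<^esub> k"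
  have U: "?U \<in> carrier H" and U': "?U' \<in> carrier H" using h h' k by auto
  obtain g where g: "g \<in> carrier G" "h' = h \<otimes>\<^bsub>H\<^esub> \<iota> g"
    using vertex_eq_iff h h' by metis
  have "stable_length (stable_pm (\<not> e) \<otimes>\<^bsub>H\<^esub> ?U) < stable_length ?U"
    using less(1) h k stable_pm_closed by (simp add: tree_dist_vertex inv_mult_stable_pm)
  then obtain n where n: "nf ?U = Syllable \<one> e n"
    by (rule stable_length_decreases[OF U])
  have "stable_length (stable_pm (\<not> e') \<otimes>\<^bsub>H\<^esub> ?U') < stable_length ?U'"
    using less(2) h'(3) k stable_pm_closed h'(1) unfolding h'(2)
    by (simp add: tree_dist_vertex inv_mult_stable_pm)
  then obtain n' where n': "nf ?U' = Syllable \<one> e' n'"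
    by (rule stable_length_decreases[OF U'])
  have "?U' = \<iota> (inv g) \<otimes>\<^bsub>H\<^esub> ?U"
    using h k g \<iota>_closed by (simp add: ext.inv_mult_group inv_\<iota> ext.m_assoc)
  then have "nf ?U' = base_act (inv g) (nf ?U)"
    using nf_base_mult U g by simp
  then have "e' = e" "rep e (inv g) = \<one>" using n n' g by auto
  then have "inv g \<in> assoc_sub e"
    using rep_one_iff[of "inv g" e] g by simp
  then have "g \<in> assoc_sub e"
    using subgroup.m_inv_closed[OF assoc_sub] inv_inv[OF g(1)] by metis
  then show "p = q"
    using vertex_mult_stable_pm_cong[OF h(1), of g e] g h h' \<open>e' = e\<close> by simp
qed

lemma lcoset_vertex:
  "x \<in> carrier H \<Longrightarrow> h \<in> carrier H \<Longrightarrow> x <#\<^bsub>H\<^esub> vertex h = vertex (x \<otimes>\<^bsub>H\<^esub> h)"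
  unfolding vertex_def by (rule ext.lcos_m_assoc[OF subgroup.subset[OF base_sub]])

lemma fixes_vertex_iff:
  assumes "x \<in> carrier H" "h \<in> carrier H"
  shows "x <#\<^bsub>H\<^esub> vertex h = vertex h \<longleftrightarrow> inv\<^bsub>H\<^esub> h \<otimes>\<^bsub>H\<^esub> x \<otimes>\<^bsub>H\<^esub> h \<in> \<iota> ` carrier G"
  using assms vertex_eq_iff'[of h "x \<otimes>\<^bsub>H\<^esub> h"] lcoset_vertex[OF assms]
  by (simp add: ext.m_assoc eq_commute)

lemma csa_star_vertex_stabilizer:
  assumes csa: "csa_star_on G (carrier G)" and h: "h \<in> carrier H"
  shows "csa_star_on H {x \<in> carrier H. x <#\<^bsub>H\<^esub> vertex h = vertex h}"
proof -
  define f where "f g = h \<otimes>\<^bsub>H\<^esub> \<iota> g \<otimes>\<^bsub>H\<^esub> inv\<^bsub>H\<^esub> h" for g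
  have "f \<in> hom G H"
  proof (rule homI)
    show "f g \<in> carrier H" if "g \<in> carrier G" for g
      using that h \<iota>_closed by (simp add: f_def)
    show "f (g \<otimes> k) = f g \<otimes>\<^bsub>H\<^esub> f k" if "g \<in> carrier G" "k \<in> carrier G" for g k
      using that h \<iota>_closed by (simp add: f_def \<iota>_mult ext.m_assoc ext.inv_mult_cancel_left)
  qed
  moreover have pullback: "inv\<^bsub>H\<^esub> h \<otimes>\<^bsub>H\<^esub> f g \<otimes>\<^bsub>H\<^esub> h = \<iota> g" if "g \<in> carrier G" for g
    using that h \<iota>_closed by (simp add: f_def ext.m_assoc ext.inv_mult_cancel_left)
  then have "inj_on f (carrier G)"
    using inj_\<iota> unfolding inj_on_def by metis
  ultimately have "csa_star_on H (f ` carrier G)"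
    using csa csa_star_on_image is_group ext.is_group by blast
  moreover have "f ` carrier G = {x \<in> carrier H. x <#\<^bsub>H\<^esub> vertex h = vertex h}"
  proof (intro equalityI subsetI)
    fix x assume "x \<in> f ` carrier G"
    then obtain g where g: "g \<in> carrier G" "x = f g" by blast
    then have "x \<in> carrier H" using h \<iota>_closed by (simp add: f_def)
    then show "x \<in> {x \<in> carrier H. x <#\<^bsub>H\<^esub> vertex h = vertex h}"
      using fixes_vertex_iff[OF _ h] pullback g by auto
  next
    fix x assume "x \<in> {x \<in> carrier H. x <#\<^bsub>H\<^esub> vertex h = vertex h}"
    then have x: "x \<in> carrier H" and "inv\<^bsub>H\<^esub> h \<otimes>\<^bsub>H\<^esub> x \<otimes>\<^bsub>H\<^esub> h \<in> \<iota> ` carrier G"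
      using fixes_vertex_iff[OF _ h] by auto
    then obtain g where g: "g \<in> carrier G" "inv\<^bsub>H\<^esub> h \<otimes>\<^bsub>H\<^esub> x \<otimes>\<^bsub>H\<^esub> h = \<iota> g" by auto
    have "f g = x"
      unfolding f_def g(2)[symmetric] using x h by (simp add: ext.m_assoc ext.mult_inv_cancel_left)
    then show "x \<in> f ` carrier G" using g(1) by blast
  qed
  ultimately show ?thesis by simp
qed

text \<open>At the vertex \<open>G\<close> the outgoing edges have the conjugates of \<open>A\<close> as stabilizers and the incoming
  edges those of \<open>B\<close>. An outgoing edge therefore shares no nontrivial stabilizer element with any
  other edge at its source.\<close>

lemma hnn_edge_rigid:
  assumes mal: "\<And>g a. g \<in> carrier G - A \<Longrightarrow> a \<in> A \<Longrightarrow> inv g \<otimes> a \<otimes> g \<in> A \<Longrightarrow> a = \<one>"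
    and sep: "\<And>g a. g \<in> carrier G \<Longrightarrow> a \<in> A \<Longrightarrow> inv g \<otimes> a \<otimes> g \<in> B \<Longrightarrow> a = \<one>"
    and x: "x \<in> carrier H" and uv: "(u, v) \<in> tree_edges"
    and uw: "(u, w) \<in> tree_edges \<union> tree_edges\<inverse>" and ne: "w \<noteq> v"
    and fixed: "x <#\<^bsub>H\<^esub> u = u" "x <#\<^bsub>H\<^esub> v = v" "x <#\<^bsub>H\<^esub> w = w"
  shows "x = \<one>\<^bsub>H\<^esub>"
proof -
  let ?t = "stable_pm"
  have t: "?t e \<in> carrier H" for e by (rule stable_pm_closed)
  obtain h where h: "h \<in> carrier H" "u = vertex h" "v = vertex (h \<otimes>\<^bsub>H\<^esub> ?t True)"
    using uv by (auto simp: tree_edges_def)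
  obtain h' e where h': "h' \<in> carrier H" "u = vertex h'" "w = vertex (h' \<otimes>\<^bsub>H\<^esub> ?t e)"
    using uw unfolding tree_adj_iff by blast
  obtain g where g: "g \<in> carrier G" "h' = h \<otimes>\<^bsub>H\<^esub> \<iota> g"
    using vertex_eq_iff h h' by metis
  obtain b where b: "b \<in> carrier G" "inv\<^bsub>H\<^esub> h \<otimes>\<^bsub>H\<^esub> x \<otimes>\<^bsub>H\<^esub> h = \<iota> b"
    using fixes_vertex_iff[OF x h(1)] fixed(1) h(2) by auto
  have gH: "\<iota> g \<in> carrier H" using g(1) by (rule \<iota>_closed)
  have "inv\<^bsub>H\<^esub> (h \<otimes>\<^bsub>H\<^esub> ?t True) \<otimes>\<^bsub>H\<^esub> x \<otimes>\<^bsub>H\<^esub> (h \<otimes>\<^bsub>H\<^esub> ?t True) =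
      ?t False \<otimes>\<^bsub>H\<^esub> (inv\<^bsub>H\<^esub> h \<otimes>\<^bsub>H\<^esub> x \<otimes>\<^bsub>H\<^esub> h) \<otimes>\<^bsub>H\<^esub> ?t True"
    using x h(1) t by (simp add: ext.inv_mult_group inv_stable_pm ext.m_assoc)
  then have "?t False \<otimes>\<^bsub>H\<^esub> \<iota> b \<otimes>\<^bsub>H\<^esub> ?t True \<in> \<iota> ` carrier G"
    using fixes_vertex_iff[OF x, of "h \<otimes>\<^bsub>H\<^esub> ?t True"] fixed(2) h t b(2) by simp
  then have bA: "b \<in> A"
    using stable_conj_in_base[OF b(1), of True] by (simp add: assoc_sub_def)
  have "inv\<^bsub>H\<^esub> (h' \<otimes>\<^bsub>H\<^esub> ?t e) \<otimes>\<^bsub>H\<^esub> x \<otimes>\<^bsub>H\<^esub> (h' \<otimes>\<^bsub>H\<^esub> ?t e) =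
      ?t (\<not> e) \<otimes>\<^bsub>H\<^esub> (\<iota> (inv g) \<otimes>\<^bsub>H\<^esub> (inv\<^bsub>H\<^esub> h \<otimes>\<^bsub>H\<^esub> x \<otimes>\<^bsub>H\<^esub> h) \<otimes>\<^bsub>H\<^esub> \<iota> g) \<otimes>\<^bsub>H\<^esub> ?t e"
    using x h(1) t g gH by (simp add: ext.inv_mult_group inv_stable_pm ext.m_assoc flip: inv_\<iota>)
  also have "\<dots> = ?t (\<not> e) \<otimes>\<^bsub>H\<^esub> \<iota> (inv g \<otimes> b \<otimes> g) \<otimes>\<^bsub>H\<^esub> ?t e"
    unfolding b(2) using g b(1) by (simp add: \<iota>_mult)
  finally have "?t (\<not> e) \<otimes>\<^bsub>H\<^esub> \<iota> (inv g \<otimes> b \<otimes> g) \<otimes>\<^bsub>H\<^esub> ?t e \<in> \<iota> ` carrier G"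
    using fixes_vertex_iff[OF x, of "h' \<otimes>\<^bsub>H\<^esub> ?t e"] fixed(3) h' t by simp
  then have conj: "inv g \<otimes> b \<otimes> g \<in> assoc_sub e"
    using stable_conj_in_base[of "inv g \<otimes> b \<otimes> g" e] g(1) b(1) by simp
  have "b = \<one>"
  proof (cases e)
    case True
    have "g \<notin> A"
    proof
      assume "g \<in> A"
      then have "w = v"
        using vertex_mult_stable_pm_cong[OF h(1), of g True] h h' g True by (simp add: assoc_sub_def)
      then show False using ne by simp
    qed
    then show ?thesis using mal[of g b] g(1) bA conj True by (simp add: assoc_sub_def)
  next
    case False
    then show ?thesis using sep[of g b] g(1) bA conj by (simp add: assoc_sub_def)
  qed
  then have "inv\<^bsub>H\<^esub> h \<otimes>\<^bsub>H\<^esub> x \<otimes>\<^bsub>H\<^esub> h = \<one>\<^bsub>H\<^esub>"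
    using b(2) hom_one[OF hnn_base_hom is_group ext.is_group] by simp
  then have "h \<otimes>\<^bsub>H\<^esub> (inv\<^bsub>H\<^esub> h \<otimes>\<^bsub>H\<^esub> x \<otimes>\<^bsub>H\<^esub> h) \<otimes>\<^bsub>H\<^esub> inv\<^bsub>H\<^esub> h = \<one>\<^bsub>H\<^esub>"
    using h(1) by simp
  then show ?thesis
    using x h(1) by (simp add: ext.m_assoc ext.mult_inv_cancel_left)
qed

text \<open>The Bass-Serre tree carries the commutation properties of \<open>G\<close> over to the extension: the
  vertex stabilizers are conjugates of \<open>G\<close>, and the conditions on \<open>A\<close> and \<open>B\<close> give \<open>edge_rigid\<close>.\<close>

theorem csa_star_hnn_extension:
  assumes mal: "\<And>g a. g \<in> carrier G - A \<Longrightarrow> a \<in> A \<Longrightarrow> inv g \<otimes> a \<otimes> g \<in> A \<Longrightarrow> a = \<one>"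
    and sep: "\<And>g a. g \<in> carrier G \<Longrightarrow> a \<in> A \<Longrightarrow> inv g \<otimes> a \<otimes> g \<in> B \<Longrightarrow> a = \<one>"
    and csa: "csa_star_on G (carrier G)"
  shows "csa_star_on H (carrier H)"
proof -
  interpret oriented_tree "vertex ` carrier H" tree_edges tree_dist
    by (rule oriented_tree_hnn)
  interpret tree_action H "vertex ` carrier H" tree_edges tree_dist "\<lambda>x v. x <#\<^bsub>H\<^esub> v"
  proof
    show "vertex ` carrier H \<noteq> {}" using ext.one_closed by blast
    show "x <#\<^bsub>H\<^esub> v \<in> vertex ` carrier H" if "x \<in> carrier H" "v \<in> vertex ` carrier H" for x v
      using that by (auto simp: lcoset_vertex)
    show "\<one>\<^bsub>H\<^esub> <#\<^bsub>H\<^esub> v = v" if "v \<in> vertex ` carrier H" for v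
      using that by (auto simp: lcoset_vertex)
    show "x \<otimes>\<^bsub>H\<^esub> y <#\<^bsub>H\<^esub> v = x <#\<^bsub>H\<^esub> (y <#\<^bsub>H\<^esub> v)"
      if "x \<in> carrier H" "y \<in> carrier H" "v \<in> vertex ` carrier H" for x y v
      using that by (auto simp: lcoset_vertex ext.m_assoc)
    show "(x <#\<^bsub>H\<^esub> u, x <#\<^bsub>H\<^esub> v) \<in> tree_edges" if "x \<in> carrier H" "(u, v) \<in> tree_edges" for x u v
      using that stable_pm_closed
      by (force simp: tree_edges_def lcoset_vertex ext.m_assoc intro: image_eqI[of _ _ "x \<otimes>\<^bsub>H\<^esub> _"])
    show "tree_dist (x <#\<^bsub>H\<^esub> u) (x <#\<^bsub>H\<^esub> v) = tree_dist u v"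
      if "x \<in> carrier H" "u \<in> vertex ` carrier H" "v \<in> vertex ` carrier H" for x u v
      using that
      by (auto simp: lcoset_vertex tree_dist_vertex ext.inv_mult_group ext.m_assoc ext.inv_mult_cancel_left)
    show "x = \<one>\<^bsub>H\<^esub>"
      if "x \<in> carrier H" "(u, v) \<in> tree_edges" "(u, w) \<in> tree_edges \<union> tree_edges\<inverse>" "w \<noteq> v"
        "x <#\<^bsub>H\<^esub> u = u" "x <#\<^bsub>H\<^esub> v = v" "x <#\<^bsub>H\<^esub> w = w" for x u v w
      by (rule hnn_edge_rigid[OF mal sep that])
    show "csa_star_on H {x \<in> carrier H. x <#\<^bsub>H\<^esub> v = v}" if "v \<in> vertex ` carrier H" for v
      using that csa_star_vertex_stabilizer[OF csa] by blast
  qed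
  show ?thesis by (rule csa_star_tree_action)
qed

end

text \<open>An intersection of malnormal subgroups is malnormal: an element outside it lies outside one
  of them.\<close>

lemma mal_closure_malnormal:
  assumes "A = mal_closure G A" "g \<in> carrier G - A" "a \<in> A" "inv\<^bsub>G\<^esub> g \<otimes>\<^bsub>G\<^esub> a \<otimes>\<^bsub>G\<^esub> g \<in> A" "group G"
  shows "a = \<one>\<^bsub>G\<^esub>"
proof -
  interpret group G by fact
  obtain M where M: "malnormal M G" "A \<subseteq> M" "g \<notin> M"
    using assms(1,2) unfolding mal_closure_def by blast
  then have "M \<inter> conj_set G M g = {\<one>\<^bsub>G\<^esub>}" and sub: "subgroup M G"
    using assms(2) by (auto simp: malnormal_def)
  then have eq: "inv\<^bsub>G\<^esub> g \<otimes>\<^bsub>G\<^esub> a \<otimes>\<^bsub>G\<^esub> g = \<one>\<^bsub>G\<^esub>"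
    using assms(3,4) M(2) by (auto simp: conj_set_def)
  have c: "a \<in> carrier G" "g \<in> carrier G"
    using assms(2,3) M(2) subgroup.mem_carrier[OF sub] by auto
  have "a = g \<otimes>\<^bsub>G\<^esub> (inv\<^bsub>G\<^esub> g \<otimes>\<^bsub>G\<^esub> a \<otimes>\<^bsub>G\<^esub> g) \<otimes>\<^bsub>G\<^esub> inv\<^bsub>G\<^esub> g"
    using c by (simp add: m_assoc mult_inv_cancel_left)
  then show ?thesis using eq c by simp
qed

text \<open>Malnormality of \<open>A\<close> and strict separation, through \<open>B \<subseteq> mal_closure G B\<close>, give the two
  intersection conditions.\<close>

theorem theorem1:
  fixes G :: "('a, 'b) monoid_scheme" and A B :: "'a set" and \<phi> :: "'a \<Rightarrow> 'a"
  assumes "CSA_star_group G"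
    and "subgroup A G"
    and "subgroup B G"
    and "\<phi> \<in> iso (G\<lparr>carrier := A\<rparr>) (G\<lparr>carrier := B\<rparr>)"
    and "hnn_strictly_separated G A B"
    and "A = mal_closure G A"
    and "B \<lhd> G\<lparr>carrier := mal_closure G B\<rparr>"
  shows "CSA_star_group (hnn_extension G A \<phi>)"
proof -
  have "group G" and csa: "csa_star_on G (carrier G)"
    using assms(1) CSA_star_group_iff by auto
  then interpret hnn_iso G A B \<phi>
    using assms by (simp add: hnn_iso_def hnn_iso_axioms_def)
  have "a = \<one>\<^bsub>G\<^esub>" if "g \<in> carrier G" "a \<in> A" "inv\<^bsub>G\<^esub> g \<otimes>\<^bsub>G\<^esub> a \<otimes>\<^bsub>G\<^esub> g \<in> B" for g a
  proof -
    let ?b = "inv\<^bsub>G\<^esub> g \<otimes>\<^bsub>G\<^esub> a \<otimes>\<^bsub>G\<^esub> g"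
    have aG: "a \<in> carrier G" using A_sub that(2) by blast
    have "B \<subseteq> mal_closure G B" unfolding mal_closure_def by blast
    moreover have "a = inv\<^bsub>G\<^esub> (inv\<^bsub>G\<^esub> g) \<otimes>\<^bsub>G\<^esub> ?b \<otimes>\<^bsub>G\<^esub> inv\<^bsub>G\<^esub> g"
      using that(1) aG by (simp add: m_assoc mult_inv_cancel_left)
    ultimately have "a \<in> A \<inter> conj_set G (mal_closure G B) (inv\<^bsub>G\<^esub> g)"
      using that unfolding conj_set_def by blast
    then show ?thesis
      using assms(5) that(1) unfolding hnn_strictly_separated_def by blast
  qed
  then have "csa_star_on H (carrier H)"
    using mal_closure_malnormal[OF assms(6) _ _ _ \<open>group G\<close>] csa by (intro csa_star_hnn_extension) blast+
  then show ?thesis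
    using CSA_star_group_iff ext.is_group by blast
qed

end
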